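(* Let $\mu_n$ ($n\geq 1$) and $\mu$ be probability measures on a complete separable metric space $(M,d)$, and let $c:M\times M\to\mathbf{R}$ be such that $c(x,y)=C(d(x,y))$, where $C:[0,+\infty)\to[0,+\infty)$ is a non-decreasing continuous function with $C(0)=0$. Suppose that $C$ satisfies a doubling condition: there exists a positive constant $\lambda$ such that $C(2y)\leq\lambda C(y)$ for all $y\geq 0$. Let $a\in M$. Then the condition $$\int C(2d(x,a))\,\mu_n(dx)<\infty\ \text{ for all } n,\qquad \int C(2d(x,a))\,\mu(dx)<\infty$$ is equivalent to the condition $$\int C(d(x,a))\,\mu_n(dx)<\infty\ \text{ for all } n,\qquad \int C(d(x,a))\,\mu(dx)<\infty .$$ Moreover, when these equivalent conditions hold, $T_c(\mu_n,\mu)\to 0$ if and only if both of the following hold: (a) $\mu_n\Longrightarrow\mu$; (b$'$) $\int C(d(x,a))\,\mu_n(dx)\to\int C(d(x,a))\,\mu(dx)$ as $n\to\infty$.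
   Context: For probability measures $\mu,\nu$ on the Borel $\sigma$-field $\mathcal{B}(M)$ of a metric space $(M,d)$ and a non-negative Borel function $c:M\times M\to\mathbf{R}$, the transportation $c$-distance is $T_c(\mu,\nu)=\inf_{\pi\in\Pi}\int c(x,y)\,d\pi(x,y)$, where $\Pi$ is the set of all probability measures on $\mathcal{B}(M\times M)$ with marginals $\mu$ and $\nu$; equivalently, $T_c(\mu,\nu)=\inf \mathbf{E}\,c(X,Y)$ over all pairs of $M$-valued random elements $X,Y$ on a common probability space with distributions $\mu$ and $\nu$, respectively. The symbol $\Longrightarrow$ denotes weak convergence of probability measures.
   Formalization: The function C is additionally assumed not to be identically zero; for C = 0 the stated equivalence fails, since T_c is always 0 and (b') is trivial while weak convergence may fail (e.g. distinct point masses). *)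

theory Defs
  imports "HOL-Probability.Probability"
begin

definition couplings ::
  "'a::topological_space measure \<Rightarrow> 'a measure \<Rightarrow> ('a \<times> 'a) measure set" where
  "couplings \<mu> \<nu> = {\<pi>. prob_space \<pi> \<and> sets \<pi> = sets borel \<and>
     distr \<pi> borel fst = \<mu> \<and> distr \<pi> borel snd = \<nu>}"

(* Values in ennreal, so the infimum exists even when every coupling has infinite cost.
   The coercion ennreal sends negative reals to 0: the cost is meant to be non-negative. *)
definition transport_dist ::
  "('a::topological_space \<Rightarrow> 'a \<Rightarrow> real) \<Rightarrow> 'a measure \<Rightarrow> 'a measure \<Rightarrow> ennreal" where
  "transport_dist c \<mu> \<nu> = (INF \<pi>\<in>couplings \<mu> \<nu>. \<integral>\<^sup>+ (x, y). ennreal (c x y) \<partial>\<pi>)"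

(* The library's weak_conv_m is defined through distribution functions, for measures
   on the real line only. *)
definition weakly_converges ::
  "(nat \<Rightarrow> 'a::topological_space measure) \<Rightarrow> 'a measure \<Rightarrow> bool" where
  "weakly_converges \<mu>s \<mu> \<longleftrightarrow>
     (\<forall>f :: 'a \<Rightarrow> real. continuous_on UNIV f \<longrightarrow> bounded (range f) \<longrightarrow>
        (\<lambda>n. \<integral>x. f x \<partial>\<mu>s n) \<longlonglongrightarrow> (\<integral>x. f x \<partial>\<mu>))"

end

theory Submission
  imports Defs
begin

text \<open>
  Write \<open>c x y = C (dist x y)\<close>. Doubling and monotonicity give \<open>C (s + t) \<le> K * C s + K * C t\<close>,
  and \<open>C\<close> is positive away from \<open>0\<close>. The first equivalence is immediate:
  \<open>C t \<le> C (2 * t) \<le> K * C t\<close>.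

  Suppose that the transport distances tend to \<open>0\<close>, and couple \<open>\<mu>s n\<close> with \<open>\<mu>\<close> at small cost.
  By Markov's inequality coupled points are close with high probability, and since the second
  point always has the law \<open>\<mu>\<close>, bounded continuous functions have almost equal integrals
  (\<open>transport_convergence_imp_weak\<close>). Subadditivity bounds the part of the moment of \<open>\<mu>s n\<close> above
  a high level by the cost and a tail of \<open>\<mu>\<close> (\<open>excess_moment_le\<close>); so no mass of the moment
  escapes, and the moments converge (\<open>transport_convergence_imp_moments\<close>).

  Conversely, an explicit coupling is needed. A continuous partition of unity with supports of
  small diameter cuts both measures into pieces. Weak convergence says that matching pieces
  have almost the same mass. The common mass is moved within the supports, at small cost,
  and the little that remains is coupled independently (\<open>transport_dist_le\<close>). By subadditivity
  the cost of the remainder is bounded by moments; convergence of moments makes these uniformly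
  integrable, so a small mass has a small moment
  (\<open>weak_and_moments_imp_transport_convergence\<close>).

  Integrals of costs and moments are taken in \<open>ennreal\<close>. There \<open>G x - R\<close> is the positive part of
  the difference, and \<open>0 / 0 = 0\<close>, which spares case distinctions for pieces without mass.
\<close>

section \<open>Couplings built from weight functions\<close>

text \<open>
  In \<open>ennreal\<close> the factor \<open>w i / w i\<close> is \<open>1\<close> unless \<open>w i = 0\<close>, when it is \<open>0\<close>; in that case
  \<open>f i\<close> vanishes almost everywhere, so the factor does no harm. This absorbs all degenerate
  weights in the constructions below.
\<close>

lemma nn_integral_weights:
  fixes f :: "'i \<Rightarrow> 'a \<Rightarrow> ennreal"
  assumes h: "h \<in> borel_measurable M"
    and f: "\<And>i. i \<in> I \<Longrightarrow> f i \<in> borel_measurable M"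
    and sum_f: "\<And>x. x \<in> space M \<Longrightarrow> (\<Sum>i\<in>I. f i x) = 1"
    and mass: "\<And>i. i \<in> I \<Longrightarrow> (\<integral>\<^sup>+ x. f i x \<partial>M) = w i"
    and fin: "\<And>i. i \<in> I \<Longrightarrow> w i < top"
  shows "(\<Sum>i\<in>I. (\<integral>\<^sup>+ x. h x * f i x \<partial>M) * (w i / w i)) = (\<integral>\<^sup>+ x. h x \<partial>M)"
proof -
  have "(\<integral>\<^sup>+ x. h x * f i x \<partial>M) * (w i / w i) = (\<integral>\<^sup>+ x. h x * f i x \<partial>M)" if "i \<in> I" for i
  proof (cases "w i = 0")
    case True
    then have "AE x in M. f i x = 0"
      using mass[OF that] f[OF that] by (simp add: nn_integral_0_iff_AE)
    then have "AE x in M. h x * f i x = 0"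
      by eventually_elim simp
    then have "(\<integral>\<^sup>+ x. h x * f i x \<partial>M) = 0"
      using h f[OF that] by (subst nn_integral_0_iff_AE) auto
    then show ?thesis by simp
  next
    case False
    then show ?thesis using fin[OF that] by (simp add: ennreal_divide_self)
  qed
  then have "(\<Sum>i\<in>I. (\<integral>\<^sup>+ x. h x * f i x \<partial>M) * (w i / w i)) = (\<Sum>i\<in>I. \<integral>\<^sup>+ x. h x * f i x \<partial>M)"
    by simp
  also have "\<dots> = (\<integral>\<^sup>+ x. (\<Sum>i\<in>I. h x * f i x) \<partial>M)"
    using h f by (subst nn_integral_sum) auto
  also have "\<dots> = (\<integral>\<^sup>+ x. h x \<partial>M)"
    by (intro nn_integral_cong) (simp add: sum_distrib_left[symmetric] sum_f)
  finally show ?thesis .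
qed

text \<open>
  Split \<open>\<mu>\<close> into the pieces \<open>f i \<mu>\<close> and \<open>\<nu>\<close> into the pieces \<open>g i \<nu>\<close>. If matching pieces have
  the same mass \<open>w i\<close>, the sum of the normalised products \<open>(f i \<mu>) \<Otimes> (g i \<nu>) / w i\<close> is a
  coupling: integrating out one variable returns \<open>w i / w i\<close> times the other piece.
  Everything is written as one density with respect to \<open>\<mu> \<Otimes> \<nu>\<close>, so that no conditional
  measures occur.
\<close>

lemma coupling_of_weights:
  fixes \<mu> \<nu> :: "'a::second_countable_topology measure" and f g :: "'i \<Rightarrow> 'a \<Rightarrow> ennreal"
  assumes \<mu>: "prob_space \<mu>" "sets \<mu> = sets borel" and \<nu>: "prob_space \<nu>" "sets \<nu> = sets borel"
    and f: "\<And>i. i \<in> I \<Longrightarrow> f i \<in> borel_measurable borel"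
    and g: "\<And>i. i \<in> I \<Longrightarrow> g i \<in> borel_measurable borel"
    and sum_f: "\<And>x. (\<Sum>i\<in>I. f i x) = 1" and sum_g: "\<And>y. (\<Sum>i\<in>I. g i y) = 1"
    and mass_f: "\<And>i. i \<in> I \<Longrightarrow> (\<integral>\<^sup>+ x. f i x \<partial>\<mu>) = w i"
    and mass_g: "\<And>i. i \<in> I \<Longrightarrow> (\<integral>\<^sup>+ y. g i y \<partial>\<nu>) = w i"
    and fin: "\<And>i. i \<in> I \<Longrightarrow> w i < top"
  shows "density (\<mu> \<Otimes>\<^sub>M \<nu>) (\<lambda>(x, y). \<Sum>i\<in>I. f i x * g i y / w i) \<in> couplings \<mu> \<nu>"
proof -
  interpret \<mu>: prob_space \<mu> by fact
  interpret \<nu>: prob_space \<nu> by fact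
  interpret pair_prob_space \<mu> \<nu> ..
  define D where "D = (\<lambda>(x, y). \<Sum>i\<in>I. f i x * g i y / w i)"
  let ?\<pi> = "density (\<mu> \<Otimes>\<^sub>M \<nu>) D"
  have sets_prod: "sets (\<mu> \<Otimes>\<^sub>M \<nu>) = sets borel"
    using sets_pair_measure_cong[OF \<mu>(2) \<nu>(2)] unfolding borel_prod .
  have sp: "space \<mu> = UNIV" "space \<nu> = UNIV"
    using sets_eq_imp_space_eq[OF \<mu>(2)] sets_eq_imp_space_eq[OF \<nu>(2)] by simp_all
  have f\<mu>[measurable]: "f i \<in> borel_measurable \<mu>" if "i \<in> I" for i
    using f[OF that] \<mu>(2) by (simp cong: measurable_cong_sets)
  have g\<nu>[measurable]: "g i \<in> borel_measurable \<nu>" if "i \<in> I" for i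
    using g[OF that] \<nu>(2) by (simp cong: measurable_cong_sets)
  have D[measurable]: "D \<in> borel_measurable (\<mu> \<Otimes>\<^sub>M \<nu>)"
    unfolding D_def by measurable
  have left: "(\<integral>\<^sup>+ z. D z * h (fst z) \<partial>(\<mu> \<Otimes>\<^sub>M \<nu>)) = (\<integral>\<^sup>+ x. h x \<partial>\<mu>)"
    if [measurable]: "h \<in> borel_measurable \<mu>" for h
  proof -
    have "(\<integral>\<^sup>+ z. D z * h (fst z) \<partial>(\<mu> \<Otimes>\<^sub>M \<nu>)) = (\<integral>\<^sup>+ x. \<integral>\<^sup>+ y. D (x, y) * h x \<partial>\<nu> \<partial>\<mu>)"
      by (subst \<nu>.nn_integral_fst[symmetric]) (simp_all)
    also have "\<dots> = (\<integral>\<^sup>+ x. (\<Sum>i\<in>I. (h x * f i x) * (w i / w i)) \<partial>\<mu>)"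
    proof (rule nn_integral_cong)
      fix x
      have "(\<integral>\<^sup>+ y. D (x, y) * h x \<partial>\<nu>) = (\<integral>\<^sup>+ y. (\<Sum>i\<in>I. (h x * f i x / w i) * g i y) \<partial>\<nu>)"
        by (intro nn_integral_cong)
          (simp add: D_def sum_distrib_left sum_distrib_right divide_ennreal_def mult_ac)
      also have "\<dots> = (\<Sum>i\<in>I. (h x * f i x / w i) * w i)"
        by (subst nn_integral_sum) (auto simp: nn_integral_cmult mass_g intro!: sum.cong)
      finally show "(\<integral>\<^sup>+ y. D (x, y) * h x \<partial>\<nu>) = (\<Sum>i\<in>I. (h x * f i x) * (w i / w i))"
        by (simp add: divide_ennreal_def mult_ac)
    qed
    also have "\<dots> = (\<Sum>i\<in>I. (\<integral>\<^sup>+ x. h x * f i x \<partial>\<mu>) * (w i / w i))"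
      by (subst nn_integral_sum) (auto simp: nn_integral_multc intro!: sum.cong)
    also have "\<dots> = (\<integral>\<^sup>+ x. h x \<partial>\<mu>)"
      by (rule nn_integral_weights) (auto simp: sum_f mass_f fin)
    finally show ?thesis .
  qed
  have right: "(\<integral>\<^sup>+ z. D z * h (snd z) \<partial>(\<mu> \<Otimes>\<^sub>M \<nu>)) = (\<integral>\<^sup>+ y. h y \<partial>\<nu>)"
    if [measurable]: "h \<in> borel_measurable \<nu>" for h
  proof -
    have "(\<integral>\<^sup>+ z. D z * h (snd z) \<partial>(\<mu> \<Otimes>\<^sub>M \<nu>)) = (\<integral>\<^sup>+ y. \<integral>\<^sup>+ x. D (x, y) * h y \<partial>\<mu> \<partial>\<nu>)"
      by (subst nn_integral_snd[symmetric]) (simp_all)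
    also have "\<dots> = (\<integral>\<^sup>+ y. (\<Sum>i\<in>I. (h y * g i y) * (w i / w i)) \<partial>\<nu>)"
    proof (rule nn_integral_cong)
      fix y
      have "(\<integral>\<^sup>+ x. D (x, y) * h y \<partial>\<mu>) = (\<integral>\<^sup>+ x. (\<Sum>i\<in>I. (h y * g i y / w i) * f i x) \<partial>\<mu>)"
        by (intro nn_integral_cong)
          (simp add: D_def sum_distrib_left sum_distrib_right divide_ennreal_def mult_ac)
      also have "\<dots> = (\<Sum>i\<in>I. (h y * g i y / w i) * w i)"
        by (subst nn_integral_sum) (auto simp: nn_integral_cmult mass_f intro!: sum.cong)
      finally show "(\<integral>\<^sup>+ x. D (x, y) * h y \<partial>\<mu>) = (\<Sum>i\<in>I. (h y * g i y) * (w i / w i))"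
        by (simp add: divide_ennreal_def mult_ac)
    qed
    also have "\<dots> = (\<Sum>i\<in>I. (\<integral>\<^sup>+ y. h y * g i y \<partial>\<nu>) * (w i / w i))"
      by (subst nn_integral_sum) (auto simp: nn_integral_multc intro!: sum.cong)
    also have "\<dots> = (\<integral>\<^sup>+ y. h y \<partial>\<nu>)"
      by (rule nn_integral_weights) (auto simp: sum_g mass_g fin)
    finally show ?thesis .
  qed
  have "emeasure ?\<pi> (space ?\<pi>) = 1"
    using left[of "\<lambda>_. 1"] by (simp add: emeasure_density \<mu>.emeasure_space_1 nn_integral_set_ennreal[symmetric] cong: nn_integral_cong)
  then have "prob_space ?\<pi>" by (rule prob_spaceI)
  moreover have "distr ?\<pi> borel fst = \<mu>"
  proof (rule measure_eqI)
    fix A assume "A \<in> sets (distr ?\<pi> borel fst)"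
    then have A[measurable]: "A \<in> sets \<mu>" "A \<in> sets borel" using \<mu>(2) by auto
    have [measurable]: "fst \<in> measurable (\<mu> \<Otimes>\<^sub>M \<nu>) borel"
      using measurable_fst[of \<mu> \<nu>] \<mu>(2) by (simp cong: measurable_cong_sets)
    have "emeasure (distr ?\<pi> borel fst) A = (\<integral>\<^sup>+ z. D z * indicator A (fst z) \<partial>(\<mu> \<Otimes>\<^sub>M \<nu>))"
      by (auto simp: emeasure_distr emeasure_density indicator_def intro!: nn_integral_cong)
    then show "emeasure (distr ?\<pi> borel fst) A = emeasure \<mu> A" by (simp add: left)
  qed (simp add: \<mu>)
  moreover have "distr ?\<pi> borel snd = \<nu>"
  proof (rule measure_eqI)
    fix A assume "A \<in> sets (distr ?\<pi> borel snd)"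
    then have A[measurable]: "A \<in> sets \<nu>" "A \<in> sets borel" using \<nu>(2) by auto
    have [measurable]: "snd \<in> measurable (\<mu> \<Otimes>\<^sub>M \<nu>) borel"
      using measurable_snd[of \<mu> \<nu>] \<nu>(2) by (simp cong: measurable_cong_sets)
    have "emeasure (distr ?\<pi> borel snd) A = (\<integral>\<^sup>+ z. D z * indicator A (snd z) \<partial>(\<mu> \<Otimes>\<^sub>M \<nu>))"
      by (auto simp: emeasure_distr emeasure_density indicator_def intro!: nn_integral_cong)
    then show "emeasure (distr ?\<pi> borel snd) A = emeasure \<nu> A" by (simp add: right)
  qed (simp add: \<nu>)
  ultimately show ?thesis
    unfolding couplings_def D_def[symmetric] by (simp add: sets_prod)
qed

lemma transport_dist_le_weights:
  fixes \<mu> \<nu> :: "'a::second_countable_topology measure" and f g :: "'i \<Rightarrow> 'a \<Rightarrow> ennreal"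
  assumes \<mu>: "prob_space \<mu>" "sets \<mu> = sets borel" and \<nu>: "prob_space \<nu>" "sets \<nu> = sets borel"
    and f: "\<And>i. i \<in> I \<Longrightarrow> f i \<in> borel_measurable borel"
    and g: "\<And>i. i \<in> I \<Longrightarrow> g i \<in> borel_measurable borel"
    and sum_f: "\<And>x. (\<Sum>i\<in>I. f i x) = 1" and sum_g: "\<And>y. (\<Sum>i\<in>I. g i y) = 1"
    and mass_f: "\<And>i. i \<in> I \<Longrightarrow> (\<integral>\<^sup>+ x. f i x \<partial>\<mu>) = w i"
    and mass_g: "\<And>i. i \<in> I \<Longrightarrow> (\<integral>\<^sup>+ y. g i y \<partial>\<nu>) = w i"
    and fin: "\<And>i. i \<in> I \<Longrightarrow> w i < top"
    and c: "(\<lambda>(x, y). c x y) \<in> borel_measurable borel"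
  shows "transport_dist c \<mu> \<nu> \<le>
    (\<Sum>i\<in>I. (\<integral>\<^sup>+ x. \<integral>\<^sup>+ y. ennreal (c x y) * (f i x * g i y) \<partial>\<nu> \<partial>\<mu>) / w i)"
proof -
  interpret \<mu>: prob_space \<mu> by fact
  interpret \<nu>: prob_space \<nu> by fact
  have sets_prod: "sets (\<mu> \<Otimes>\<^sub>M \<nu>) = sets borel"
    using sets_pair_measure_cong[OF \<mu>(2) \<nu>(2)] unfolding borel_prod .
  have f\<mu>[measurable]: "f i \<in> borel_measurable \<mu>" if "i \<in> I" for i
    using f[OF that] \<mu>(2) by (simp cong: measurable_cong_sets)
  have g\<nu>[measurable]: "g i \<in> borel_measurable \<nu>" if "i \<in> I" for i
    using g[OF that] \<nu>(2) by (simp cong: measurable_cong_sets)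
  have c'[measurable]: "(\<lambda>(x, y). c x y) \<in> borel_measurable (\<mu> \<Otimes>\<^sub>M \<nu>)"
    using c sets_prod by (simp cong: measurable_cong_sets)
  define D where "D = (\<lambda>(x, y). \<Sum>i\<in>I. f i x * g i y / w i)"
  let ?\<pi> = "density (\<mu> \<Otimes>\<^sub>M \<nu>) D"
  have D[measurable]: "D \<in> borel_measurable (\<mu> \<Otimes>\<^sub>M \<nu>)"
    unfolding D_def by measurable
  have "?\<pi> \<in> couplings \<mu> \<nu>"
    unfolding D_def by (rule coupling_of_weights) fact+
  then have "transport_dist c \<mu> \<nu> \<le> (\<integral>\<^sup>+ (x, y). ennreal (c x y) \<partial>?\<pi>)"
    unfolding transport_dist_def by (rule INF_lower)
  also have "\<dots> = (\<integral>\<^sup>+ z. D z * (case z of (x, y) \<Rightarrow> ennreal (c x y)) \<partial>(\<mu> \<Otimes>\<^sub>M \<nu>))"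
    by (rule nn_integral_density) simp_all
  also have "\<dots> = (\<integral>\<^sup>+ z. (\<Sum>i\<in>I. (case z of (x, y) \<Rightarrow> ennreal (c x y) * (f i x * g i y)) / w i) \<partial>(\<mu> \<Otimes>\<^sub>M \<nu>))"
    by (intro nn_integral_cong)
      (auto simp: D_def sum_distrib_left sum_distrib_right divide_ennreal_def mult_ac split: prod.splits)
  also have "\<dots> = (\<Sum>i\<in>I. (\<integral>\<^sup>+ z. (case z of (x, y) \<Rightarrow> ennreal (c x y) * (f i x * g i y)) \<partial>(\<mu> \<Otimes>\<^sub>M \<nu>)) / w i)"
    by (subst nn_integral_sum) (auto intro!: sum.cong nn_integral_divide)
  also have "\<dots> = (\<Sum>i\<in>I. (\<integral>\<^sup>+ x. \<integral>\<^sup>+ y. ennreal (c x y) * (f i x * g i y) \<partial>\<nu> \<partial>\<mu>) / w i)"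
    by (intro sum.cong refl) (simp add: \<nu>.nn_integral_fst[symmetric])
  finally show ?thesis .
qed

text \<open>
  The pieces cut out by the same functions \<open>\<phi> i\<close> have different masses under two measures.
  Scaling piece \<open>i\<close> down to a prescribed smaller mass \<open>w i\<close> makes the masses agree, and the
  mass lost is collected in one further piece, with index \<open>k\<close>.
\<close>

lemma subpartition_rescale:
  fixes M :: "'a::topological_space measure" and \<phi> :: "nat \<Rightarrow> 'a \<Rightarrow> ennreal" and w :: "nat \<Rightarrow> ennreal"
  assumes M: "prob_space M" "sets M = sets borel"
    and \<phi>[measurable]: "\<And>i. \<phi> i \<in> borel_measurable borel"
    and sum_\<phi>: "\<And>x. (\<Sum>i<k. \<phi> i x) \<le> 1"
    and w: "\<And>i. i < k \<Longrightarrow> w i \<le> (\<integral>\<^sup>+ x. \<phi> i x \<partial>M)"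
  obtains f :: "nat \<Rightarrow> 'a \<Rightarrow> ennreal" where
    "\<And>i. f i \<in> borel_measurable borel" "\<And>x. (\<Sum>i\<le>k. f i x) = 1"
    "\<And>i. i < k \<Longrightarrow> (\<integral>\<^sup>+ x. f i x \<partial>M) = w i" "(\<integral>\<^sup>+ x. f k x \<partial>M) = 1 - (\<Sum>i<k. w i)"
    "\<And>i x. i < k \<Longrightarrow> \<phi> i x = 0 \<Longrightarrow> f i x = 0"
proof -
  interpret prob_space M by fact
  have \<phi>M[measurable]: "\<phi> i \<in> borel_measurable M" for i
    using \<phi>[of i] M(2) by (simp cong: measurable_cong_sets)
  define p where "p i = (\<integral>\<^sup>+ x. \<phi> i x \<partial>M)" for i
  define h where "h i x = \<phi> i x * (w i / p i)" for i x
  have p_fin: "p i < top" if "i < k" for i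
  proof -
    have "p i \<le> (\<integral>\<^sup>+ x. 1 \<partial>M)" unfolding p_def
    proof (rule nn_integral_mono)
      fix x
      have "\<phi> i x \<le> (\<Sum>i<k. \<phi> i x)" using that by (intro member_le_sum) auto
      then show "\<phi> i x \<le> 1" using sum_\<phi>[of x] by simp
    qed
    then show ?thesis by (simp add: emeasure_space_1 order_le_less_trans)
  qed
  have ratio: "w i / p i \<le> 1" if "i < k" for i
    using w[OF that] p_fin[OF that] divide_right_mono_ennreal[of "w i" "p i" "p i"]
    by (cases "p i = 0") (auto simp: p_def)
  have h_le: "h i x \<le> \<phi> i x" if "i < k" for i x
    using mult_left_mono[OF ratio[OF that], of "\<phi> i x"] by (simp add: h_def)
  have sum_h: "(\<Sum>i<k. h i x) \<le> 1" for x
    using sum_mono[of "{..<k}" "\<lambda>i. h i x" "\<lambda>i. \<phi> i x"] h_le sum_\<phi>[of x] by (auto intro: order_trans)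
  have int_h: "(\<integral>\<^sup>+ x. h i x \<partial>M) = w i" if "i < k" for i
  proof -
    have "(\<integral>\<^sup>+ x. h i x \<partial>M) = p i * (w i / p i)"
      unfolding h_def p_def by (rule nn_integral_multc) simp
    also have "\<dots> = w i"
    proof (cases "p i = 0")
      case True then show ?thesis using w[OF that] by (simp add: p_def)
    next
      case False
      then show ?thesis using p_fin[OF that]
        by (simp add: ennreal_times_divide mult.commute[of "p i"] ennreal_mult_divide_eq)
    qed
    finally show ?thesis .
  qed
  have h_meas[measurable]: "h i \<in> borel_measurable borel" "h i \<in> borel_measurable M" for i
    unfolding h_def by measurable
  have int_sum: "(\<integral>\<^sup>+ x. (\<Sum>i<k. h i x) \<partial>M) = (\<Sum>i<k. w i)"
    by (subst nn_integral_sum) (auto simp: int_h)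
  have "(\<Sum>i<k. w i) \<le> (\<integral>\<^sup>+ x. 1 \<partial>M)"
    unfolding int_sum[symmetric] by (intro nn_integral_mono sum_h)
  then have W: "(\<Sum>i<k. w i) \<le> 1" by (simp add: emeasure_space_1)
  have int_sum_fin: "(\<integral>\<^sup>+ x. (\<Sum>i<k. h i x) \<partial>M) \<noteq> \<infinity>"
    unfolding int_sum using W by (metis ennreal_one_less_top infinity_ennreal_def leD)
  define f where "f i x = (if i < k then h i x else 1 - (\<Sum>j<k. h j x))" for i x
  show thesis
  proof (rule that[of f])
    show "f i \<in> borel_measurable borel" for i
      unfolding f_def by measurable
    show "(\<Sum>i\<le>k. f i x) = 1" for x
      using sum_h[of x] by (simp add: f_def lessThan_Suc_atMost[symmetric] add_diff_self_ennreal)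
    show "(\<integral>\<^sup>+ x. f i x \<partial>M) = w i" if "i < k" for i
      using int_h[OF that] that by (simp add: f_def)
    have "(\<integral>\<^sup>+ x. f k x \<partial>M) = (\<integral>\<^sup>+ x. 1 \<partial>M) - (\<integral>\<^sup>+ x. (\<Sum>i<k. h i x) \<partial>M)"
      unfolding f_def using int_sum_fin by (subst nn_integral_diff[symmetric]) (auto simp: sum_h)
    then show "(\<integral>\<^sup>+ x. f k x \<partial>M) = 1 - (\<Sum>i<k. w i)"
      by (simp add: int_sum emeasure_space_1)
    show "f i x = 0" if "i < k" "\<phi> i x = 0" for i x
      using that by (simp add: f_def h_def)
  qed
qed

text \<open>
  Since subtraction on \<open>ennreal\<close> is truncated, \<open>G x - R\<close> is the positive part of the excess
  of \<open>G\<close> over the level \<open>R\<close>. Up to this level, \<open>G\<close> costs at most \<open>R\<close> per unit of mass of \<open>f\<close>.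
\<close>

lemma nn_integral_le_truncation:
  fixes G f :: "'a \<Rightarrow> ennreal"
  assumes [measurable]: "G \<in> borel_measurable M" "f \<in> borel_measurable M" and f: "\<And>x. f x \<le> 1"
  shows "(\<integral>\<^sup>+ x. G x * f x \<partial>M) \<le> R * (\<integral>\<^sup>+ x. f x \<partial>M) + (\<integral>\<^sup>+ x. G x - R \<partial>M)"
proof -
  have "(\<integral>\<^sup>+ x. G x * f x \<partial>M) \<le> (\<integral>\<^sup>+ x. R * f x + (G x - R) \<partial>M)"
  proof (rule nn_integral_mono)
    fix x
    have "G x \<le> R + (G x - R)" by (auto simp: add_diff_self_ennreal)
    then have "G x * f x \<le> (R + (G x - R)) * f x" by (rule mult_right_mono) simp
    also have "\<dots> \<le> R * f x + (G x - R)"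
      using mult_left_mono[OF f, of "G x - R"] by (simp add: distrib_right add_left_mono)
    finally show "G x * f x \<le> R * f x + (G x - R)" .
  qed
  also have "\<dots> = R * (\<integral>\<^sup>+ x. f x \<partial>M) + (\<integral>\<^sup>+ x. G x - R \<partial>M)"
    by (simp add: nn_integral_add nn_integral_cmult)
  finally show ?thesis .
qed

text \<open>
  Below each \<open>\<phi> i\<close>, the common mass of \<open>\<mu>\<close> and \<open>\<nu>\<close> is moved inside the support of
  \<open>\<phi> i\<close>, at a cost of at most \<open>\<delta>\<close> per unit of mass. The rest of the mass is coupled
  independently; there the cost is split as \<open>G x + G y\<close>, and each half contributes at most
  \<open>R\<close> times the remaining mass, plus the excess of \<open>G\<close> over \<open>R\<close>.
\<close>

lemma transport_dist_le:
  fixes \<mu> \<nu> :: "'a::second_countable_topology measure" and \<phi> :: "nat \<Rightarrow> 'a \<Rightarrow> ennreal"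
  assumes \<mu>: "prob_space \<mu>" "sets \<mu> = sets borel" and \<nu>: "prob_space \<nu>" "sets \<nu> = sets borel"
    and \<phi>: "\<And>i. \<phi> i \<in> borel_measurable borel" and sum_\<phi>: "\<And>x. (\<Sum>i<k. \<phi> i x) \<le> 1"
    and near: "\<And>i x y. \<phi> i x > 0 \<Longrightarrow> \<phi> i y > 0 \<Longrightarrow> ennreal (c x y) \<le> \<delta>"
    and c: "(\<lambda>(x, y). c x y) \<in> borel_measurable borel"
    and G[measurable]: "G \<in> borel_measurable borel" and c_le: "\<And>x y. ennreal (c x y) \<le> G x + G y"
  shows "transport_dist c \<mu> \<nu> \<le>
    \<delta> + 2 * R * (1 - (\<Sum>i<k. min (\<integral>\<^sup>+ x. \<phi> i x \<partial>\<mu>) (\<integral>\<^sup>+ x. \<phi> i x \<partial>\<nu>)))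
      + (\<integral>\<^sup>+ x. G x - R \<partial>\<mu>) + (\<integral>\<^sup>+ x. G x - R \<partial>\<nu>)"
proof -
  interpret \<mu>: prob_space \<mu> by fact
  interpret \<nu>: prob_space \<nu> by fact
  define w where "w i = min (\<integral>\<^sup>+ x. \<phi> i x \<partial>\<mu>) (\<integral>\<^sup>+ x. \<phi> i x \<partial>\<nu>)" for i
  define W where "W = 1 - (\<Sum>i<k. w i)"
  define v where "v i = (if i < k then w i else W)" for i
  have w_\<mu>: "w i \<le> (\<integral>\<^sup>+ x. \<phi> i x \<partial>\<mu>)" and w_\<nu>: "w i \<le> (\<integral>\<^sup>+ x. \<phi> i x \<partial>\<nu>)" for i
    by (simp_all add: w_def)
  obtain f where f: "\<And>i. f i \<in> borel_measurable borel" "\<And>x. (\<Sum>i\<le>k. f i x) = 1"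
      "\<And>i. i < k \<Longrightarrow> (\<integral>\<^sup>+ x. f i x \<partial>\<mu>) = w i" "(\<integral>\<^sup>+ x. f k x \<partial>\<mu>) = W"
      "\<And>i x. i < k \<Longrightarrow> \<phi> i x = 0 \<Longrightarrow> f i x = 0"
    using subpartition_rescale[OF \<mu> \<phi> sum_\<phi> w_\<mu>, folded W_def] by blast
  obtain g where g: "\<And>i. g i \<in> borel_measurable borel" "\<And>x. (\<Sum>i\<le>k. g i x) = 1"
      "\<And>i. i < k \<Longrightarrow> (\<integral>\<^sup>+ x. g i x \<partial>\<nu>) = w i" "(\<integral>\<^sup>+ x. g k x \<partial>\<nu>) = W"
      "\<And>i x. i < k \<Longrightarrow> \<phi> i x = 0 \<Longrightarrow> g i x = 0"
    using subpartition_rescale[OF \<nu> \<phi> sum_\<phi> w_\<nu>, folded W_def] by blast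
  have meas[measurable]: "f i \<in> borel_measurable \<mu>" "g i \<in> borel_measurable \<nu>"
      "G \<in> borel_measurable \<mu>" "G \<in> borel_measurable \<nu>" for i
    using f(1)[of i] g(1)[of i] G \<mu>(2) \<nu>(2) by (simp_all cong: measurable_cong_sets)
  have f_le: "f i x \<le> 1" and g_le: "g i x \<le> 1" if "i \<le> k" for i x
    using member_le_sum[of i "{..k}" "\<lambda>i. f i x"] member_le_sum[of i "{..k}" "\<lambda>i. g i x"] f(2) g(2) that
    by auto
  have v_f: "(\<integral>\<^sup>+ x. f i x \<partial>\<mu>) = v i" and v_g: "(\<integral>\<^sup>+ x. g i x \<partial>\<nu>) = v i" if "i \<le> k" for i
    using that f(3,4) g(3,4) by (auto simp: v_def)
  have v_le: "v i \<le> 1" if "i \<le> k" for i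
    using nn_integral_mono[of \<mu> "f i" "\<lambda>_. 1"] f_le[OF that] v_f[OF that] by (simp add: \<mu>.emeasure_space_1)
  then have v_fin: "v i < top" if "i \<le> k" for i
    using that by (meson ennreal_one_less_top order_le_less_trans)
  have v_ratio: "v i / v i \<le> 1" if "i \<le> k" for i
    using v_fin[OF that] by (cases "v i = 0") auto
  let ?t = "\<lambda>i. (\<integral>\<^sup>+ x. \<integral>\<^sup>+ y. ennreal (c x y) * (f i x * g i y) \<partial>\<nu> \<partial>\<mu>) / v i"
  \<comment> \<open>both points of a matched pair lie in the support of the same function\<close>
  have diagonal: "?t i \<le> \<delta> * w i" if i: "i < k" for i
  proof -
    have "(\<integral>\<^sup>+ x. \<integral>\<^sup>+ y. ennreal (c x y) * (f i x * g i y) \<partial>\<nu> \<partial>\<mu>)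
        \<le> (\<integral>\<^sup>+ x. \<integral>\<^sup>+ y. \<delta> * f i x * g i y \<partial>\<nu> \<partial>\<mu>)"
    proof (intro nn_integral_mono)
      fix x y
      show "ennreal (c x y) * (f i x * g i y) \<le> \<delta> * f i x * g i y"
        using near[of i x y] f(5)[OF i, of x] g(5)[OF i, of y]
        by (cases "\<phi> i x = 0"; cases "\<phi> i y = 0") (auto simp: mult.assoc zero_less_iff_neq_zero intro: mult_right_mono)
    qed
    also have "\<dots> = \<delta> * v i * v i"
      using i by (simp add: nn_integral_cmult nn_integral_multc v_f v_g)
    finally have "?t i \<le> \<delta> * v i * v i / v i" by (rule divide_right_mono_ennreal)
    also have "\<dots> = \<delta> * v i * (v i / v i)" by (simp add: ennreal_times_divide)
    also have "\<dots> \<le> \<delta> * v i" using mult_left_mono[OF v_ratio[of i], of "\<delta> * v i"] i by simp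
    finally show ?thesis using i by (simp add: v_def)
  qed
  let ?A = "\<integral>\<^sup>+ x. G x * f k x \<partial>\<mu>" and ?B = "\<integral>\<^sup>+ y. G y * g k y \<partial>\<nu>"
  have rest: "?t k \<le> ?A + ?B"
  proof -
    have "(\<integral>\<^sup>+ x. \<integral>\<^sup>+ y. ennreal (c x y) * (f k x * g k y) \<partial>\<nu> \<partial>\<mu>)
        \<le> (\<integral>\<^sup>+ x. \<integral>\<^sup>+ y. G x * f k x * g k y + f k x * (G y * g k y) \<partial>\<nu> \<partial>\<mu>)"
    proof (intro nn_integral_mono)
      fix x y
      show "ennreal (c x y) * (f k x * g k y) \<le> G x * f k x * g k y + f k x * (G y * g k y)"
        using mult_right_mono[OF c_le[of x y], of "f k x * g k y"] by (simp add: distrib_right distrib_left mult_ac)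
    qed
    also have "\<dots> = (\<integral>\<^sup>+ x. G x * f k x * v k + f k x * ?B \<partial>\<mu>)"
      by (simp add: nn_integral_add nn_integral_cmult v_g)
    also have "\<dots> = (?A + ?B) * v k"
      by (simp add: nn_integral_add nn_integral_multc v_f distrib_right mult.commute[of "v k" ?B])
    finally have "?t k \<le> (?A + ?B) * v k / v k" by (rule divide_right_mono_ennreal)
    also have "\<dots> = (?A + ?B) * (v k / v k)" by (simp add: ennreal_times_divide)
    also have "\<dots> \<le> ?A + ?B" using mult_left_mono[OF v_ratio[of k], of "?A + ?B"] by simp
    finally show ?thesis .
  qed
  have sum_w: "(\<Sum>i<k. w i) \<le> 1"
  proof -
    have "(\<Sum>i<k. w i) = (\<integral>\<^sup>+ x. (\<Sum>i<k. f i x) \<partial>\<mu>)"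
      by (subst nn_integral_sum) (auto simp: f(3))
    also have "\<dots> \<le> (\<integral>\<^sup>+ x. 1 \<partial>\<mu>)"
    proof (rule nn_integral_mono)
      fix x
      have "(\<Sum>i<k. f i x) \<le> (\<Sum>i\<le>k. f i x)" by (rule sum_mono2) auto
      then show "(\<Sum>i<k. f i x) \<le> 1" by (simp add: f(2))
    qed
    finally show ?thesis by (simp add: \<mu>.emeasure_space_1)
  qed
  have "transport_dist c \<mu> \<nu> \<le> (\<Sum>i\<le>k. ?t i)"
    by (rule transport_dist_le_weights[OF \<mu> \<nu>]) (use f g c v_f v_g v_fin in auto)
  also have "\<dots> = (\<Sum>i<k. ?t i) + ?t k" by (simp add: lessThan_Suc_atMost[symmetric])
  also have "\<dots> \<le> (\<Sum>i<k. \<delta> * w i) + (?A + ?B)"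
    using diagonal rest by (intro add_mono sum_mono) auto
  also have "\<dots> \<le> \<delta> + ((R * W + (\<integral>\<^sup>+ x. G x - R \<partial>\<mu>)) + (R * W + (\<integral>\<^sup>+ x. G x - R \<partial>\<nu>)))"
  proof (intro add_mono)
    show "(\<Sum>i<k. \<delta> * w i) \<le> \<delta>"
      using mult_left_mono[OF sum_w, of \<delta>] by (simp add: sum_distrib_left)
    show "?A \<le> R * W + (\<integral>\<^sup>+ x. G x - R \<partial>\<mu>)"
      using nn_integral_le_truncation[of G \<mu> "f k" R] f_le[of k] by (simp add: f(4))
    show "?B \<le> R * W + (\<integral>\<^sup>+ x. G x - R \<partial>\<nu>)"
      using nn_integral_le_truncation[of G \<nu> "g k" R] g_le[of k] by (simp add: g(4))
  qed
  also have "\<dots> = \<delta> + 2 * R * W + (\<integral>\<^sup>+ x. G x - R \<partial>\<mu>) + (\<integral>\<^sup>+ x. G x - R \<partial>\<nu>)"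
    by (simp add: mult_2 distrib_right add_ac)
  finally show ?thesis by (simp add: W_def w_def)
qed

section \<open>Test functions and truncated integrals\<close>

text \<open>
  Bump functions \<open>b i\<close> around a dense sequence are turned into a partition of unity by
  \<open>b i * (\<Prod>j<i. 1 - b j)\<close>, whose partial sums telescope to \<open>1 - (\<Prod>j<k. 1 - b j)\<close>. Since
  some bump equals \<open>1\<close> at any given point, the partial sums reach \<open>1\<close> there. Continuous
  functions take the place of a partition into sets, so that weak convergence applies to
  their integrals directly from its definition.
\<close>

lemma partition_of_unity_small_supports:
  fixes \<epsilon> :: real
  assumes \<epsilon>: "\<epsilon> > 0"
  obtains \<phi> :: "nat \<Rightarrow> 'a::{metric_space, second_countable_topology} \<Rightarrow> real" where
    "\<And>i. continuous_on UNIV (\<phi> i)" "\<And>i x. 0 \<le> \<phi> i x" "\<And>k x. (\<Sum>i<k. \<phi> i x) \<le> 1"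
    "\<And>x. (\<lambda>i. \<phi> i x) sums 1" "\<And>i x y. \<phi> i x > 0 \<Longrightarrow> \<phi> i y > 0 \<Longrightarrow> dist x y < \<epsilon>"
proof -
  obtain D :: "'a set" where D: "countable D" "\<And>U. open U \<Longrightarrow> U \<noteq> {} \<Longrightarrow> \<exists>d\<in>D. d \<in> U"
    using countable_dense_setE by blast
  have "D \<noteq> {}" using D(2)[OF open_UNIV] by auto
  define p where "p = from_nat_into D"
  \<comment> \<open>every point has some member of the sequence arbitrarily close\<close>
  have p_near: "\<exists>i. dist x (p i) < r" if "r > 0" for x r
  proof -
    obtain d where "d \<in> D" "dist x d < r"
      using D(2)[of "ball x r"] \<open>r > 0\<close> by (auto simp: mem_ball)
    moreover obtain i where "from_nat_into D i = d"
      using from_nat_into_surj[OF D(1) \<open>d \<in> D\<close>] by blast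
    ultimately show ?thesis unfolding p_def by blast
  qed
  define b where "b i x = max 0 (min 1 (2 - 4 * dist x (p i) / \<epsilon>))" for i x
  have b01: "0 \<le> b i x" "b i x \<le> 1" for i x by (auto simp: b_def)
  have b_cont: "continuous_on UNIV (b i)" for i
    unfolding b_def using \<epsilon> by (auto intro!: continuous_intros)
  have b_pos: "dist x (p i) < \<epsilon> / 2" if "b i x > 0" for i x
    using that \<epsilon> by (auto simp: b_def field_simps max_def split: if_splits)
  have b_one: "b i x = 1" if "dist x (p i) < \<epsilon> / 4" for i x
    using that \<epsilon> by (auto simp: b_def field_simps max_def min_def)
  define \<phi> where "\<phi> i x = b i x * (\<Prod>j<i. 1 - b j x)" for i x
  have sum_\<phi>: "(\<Sum>i<k. \<phi> i x) = 1 - (\<Prod>j<k. 1 - b j x)" for k x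
    by (induction k) (auto simp: \<phi>_def algebra_simps)
  have prod0: "0 \<le> (\<Prod>j<k. 1 - b j x)" for k x
    using b01 by (intro prod_nonneg) auto
  show thesis
  proof (rule that[of \<phi>])
    show "continuous_on UNIV (\<phi> i)" for i
      unfolding \<phi>_def by (intro continuous_intros b_cont)
    show "0 \<le> \<phi> i x" for i x
      unfolding \<phi>_def using b01 prod0 by simp
    show "(\<Sum>i<k. \<phi> i x) \<le> 1" for k x
      using prod0 by (simp add: sum_\<phi>)
    show "(\<lambda>i. \<phi> i x) sums 1" for x
    proof -
      obtain m where m: "dist x (p m) < \<epsilon> / 4" using p_near[of "\<epsilon> / 4" x] \<epsilon> by auto
      have "(\<Sum>i<k. \<phi> i x) = 1" if "k > m" for k
        using b_one[OF m] that by (auto simp: sum_\<phi> intro!: prod_zero)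
      then have "eventually (\<lambda>k. (\<Sum>i<k. \<phi> i x) = 1) sequentially"
        by (intro eventually_mono[OF eventually_gt_at_top[of m]])
      then show ?thesis unfolding sums_def by (rule tendsto_eventually)
    qed
    show "dist x y < \<epsilon>" if "\<phi> i x > 0" "\<phi> i y > 0" for i x y
    proof -
      have b: "b i x > 0" "b i y > 0"
        using that b01[of i x] b01[of i y] by (auto simp: \<phi>_def zero_less_mult_iff)
      have "dist x (p i) < \<epsilon> / 2" "dist y (p i) < \<epsilon> / 2" using b by (simp_all only: b_pos)
      then show ?thesis using dist_triangle2[of x y "p i"] by simp
    qed
  qed
qed

lemma weakly_converges_nn_integral:
  fixes \<mu>s :: "nat \<Rightarrow> 'a::topological_space measure" and f :: "'a \<Rightarrow> real"
  assumes \<mu>s: "\<And>n. n \<ge> 1 \<Longrightarrow> prob_space (\<mu>s n)" "\<And>n. n \<ge> 1 \<Longrightarrow> sets (\<mu>s n) = sets borel"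
    and \<mu>: "prob_space \<mu>" "sets \<mu> = sets borel"
    and conv: "weakly_converges \<mu>s \<mu>"
    and f: "continuous_on UNIV f" "\<And>x. 0 \<le> f x" "\<And>x. f x \<le> B"
  shows "(\<lambda>n. \<integral>\<^sup>+ x. ennreal (f x) \<partial>\<mu>s n) \<longlonglongrightarrow> (\<integral>\<^sup>+ x. ennreal (f x) \<partial>\<mu>)"
proof -
  have eq: "(\<integral>\<^sup>+ x. ennreal (f x) \<partial>M) = ennreal (\<integral>x. f x \<partial>M)"
    if "prob_space M" "sets M = sets borel" for M
  proof (rule nn_integral_eq_integral)
    interpret prob_space M by fact
    show "integrable M f"
    proof (rule integrable_const_bound[where B=B])
      show "f \<in> borel_measurable M"
        using borel_measurable_continuous_onI[OF f(1)] that(2) by (simp cong: measurable_cong_sets)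
    qed (use f in auto)
  qed (use f in auto)
  have "bounded (range f)"
    using f by (intro boundedI[where B=B]) auto
  then have "(\<lambda>n. \<integral>x. f x \<partial>\<mu>s n) \<longlonglongrightarrow> (\<integral>x. f x \<partial>\<mu>)"
    using conv f(1) unfolding weakly_converges_def by blast
  then have "(\<lambda>n. ennreal (\<integral>x. f x \<partial>\<mu>s n)) \<longlonglongrightarrow> ennreal (\<integral>x. f x \<partial>\<mu>)"
    by (rule tendsto_ennrealI)
  moreover have "eventually (\<lambda>n. ennreal (\<integral>x. f x \<partial>\<mu>s n) = (\<integral>\<^sup>+ x. ennreal (f x) \<partial>\<mu>s n)) sequentially"
    using eventually_ge_at_top[of 1] by eventually_elim (simp add: eq \<mu>s)
  ultimately show ?thesis
    by (subst eq[OF \<mu>]) (rule Lim_transform_eventually)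
qed

lemma nn_integral_min_tendsto:
  fixes G :: "'a \<Rightarrow> ennreal"
  assumes [measurable]: "G \<in> borel_measurable M"
  shows "(\<lambda>N::nat. \<integral>\<^sup>+ x. min (G x) (of_nat N) \<partial>M) \<longlonglongrightarrow> (\<integral>\<^sup>+ x. G x \<partial>M)"
proof (rule nn_integral_LIMSEQ)
  show "incseq (\<lambda>N x. min (G x) (of_nat N))"
    by (intro incseq_SucI le_funI min.mono order_refl) simp
  show "(\<lambda>N. min (G x) (of_nat N)) \<longlonglongrightarrow> G x" for x
    using tendsto_min[OF tendsto_const of_nat_tendsto_top_ennreal, of "G x"] by simp
qed simp

text \<open>
  The decomposition of an integral into its part below a level and its excess over it is
  what compares moments with bounded integrals, on which weak convergence has a grip.
\<close>

lemma nn_integral_split_min: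
  fixes G :: "'a \<Rightarrow> ennreal"
  assumes [measurable]: "G \<in> borel_measurable M"
  shows "(\<integral>\<^sup>+ x. G x \<partial>M) = (\<integral>\<^sup>+ x. min (G x) R \<partial>M) + (\<integral>\<^sup>+ x. G x - R \<partial>M)"
proof -
  have "G x = min (G x) R + (G x - R)" for x
    by (cases "G x = top"; cases "G x \<le> R")
      (auto simp: min_def diff_eq_0_iff_ennreal add_diff_self_ennreal less_top)
  then have "(\<integral>\<^sup>+ x. G x \<partial>M) = (\<integral>\<^sup>+ x. min (G x) R + (G x - R) \<partial>M)" by presburger
  then show ?thesis by (simp add: nn_integral_add)
qed

lemma nn_integral_excess:
  fixes G :: "'a \<Rightarrow> ennreal"
  assumes G: "G \<in> borel_measurable M" and fin: "(\<integral>\<^sup>+ x. G x \<partial>M) < top"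
  shows "(\<integral>\<^sup>+ x. G x - R \<partial>M) = (\<integral>\<^sup>+ x. G x \<partial>M) - (\<integral>\<^sup>+ x. min (G x) R \<partial>M)"
proof -
  have "(\<integral>\<^sup>+ x. min (G x) R \<partial>M) < top"
    using fin by (intro le_less_trans[OF nn_integral_mono fin]) simp
  then show ?thesis
    unfolding nn_integral_split_min[OF G, of R] by simp
qed

lemma nn_integral_excess_tendsto_0:
  fixes G :: "'a \<Rightarrow> ennreal"
  assumes G: "G \<in> borel_measurable M" and fin: "(\<integral>\<^sup>+ x. G x \<partial>M) < top"
  shows "(\<lambda>N::nat. \<integral>\<^sup>+ x. G x - of_nat N \<partial>M) \<longlonglongrightarrow> 0"
proof -
  have "(\<lambda>N::nat. (\<integral>\<^sup>+ x. G x \<partial>M) - (\<integral>\<^sup>+ x. min (G x) (of_nat N) \<partial>M))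
      \<longlonglongrightarrow> (\<integral>\<^sup>+ x. G x \<partial>M) - (\<integral>\<^sup>+ x. G x \<partial>M)"
    using fin by (intro tendsto_diff_ennreal_general tendsto_const nn_integral_min_tendsto G) auto
  then show ?thesis using fin by (simp add: nn_integral_excess[OF G fin])
qed

lemma weakly_converges_nn_integral_min:
  fixes \<mu>s :: "nat \<Rightarrow> 'a::topological_space measure" and h :: "'a \<Rightarrow> real"
  assumes \<mu>s: "\<And>n. n \<ge> 1 \<Longrightarrow> prob_space (\<mu>s n)" "\<And>n. n \<ge> 1 \<Longrightarrow> sets (\<mu>s n) = sets borel"
    and \<mu>: "prob_space \<mu>" "sets \<mu> = sets borel"
    and conv: "weakly_converges \<mu>s \<mu>"
    and h: "continuous_on UNIV h" "\<And>x. 0 \<le> h x"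
  shows "(\<lambda>n. \<integral>\<^sup>+ x. min (ennreal (h x)) (of_nat N) \<partial>\<mu>s n)
    \<longlonglongrightarrow> (\<integral>\<^sup>+ x. min (ennreal (h x)) (of_nat N) \<partial>\<mu>)"
proof -
  have "min (ennreal (h x)) (of_nat N) = ennreal (min (h x) (real N))" for x
    using h(2)[of x] by (simp add: ennreal_of_nat_eq_real_of_nat min_def ennreal_le_iff)
  moreover have "(\<lambda>n. \<integral>\<^sup>+ x. ennreal (min (h x) (real N)) \<partial>\<mu>s n)
      \<longlonglongrightarrow> (\<integral>\<^sup>+ x. ennreal (min (h x) (real N)) \<partial>\<mu>)"
    by (rule weakly_converges_nn_integral[where B="real N", OF \<mu>s \<mu> conv])
      (use h in \<open>auto intro!: continuous_intros\<close>)
  ultimately show ?thesis by simp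
qed

text \<open>
  Convergence of the moments turns into uniform integrability: the integrals and their
  truncations converge, hence so do the differences, which are the excesses.
\<close>

lemma weakly_converges_nn_integral_excess:
  fixes \<mu>s :: "nat \<Rightarrow> 'a::topological_space measure" and h :: "'a \<Rightarrow> real"
  assumes \<mu>s: "\<And>n. n \<ge> 1 \<Longrightarrow> prob_space (\<mu>s n)" "\<And>n. n \<ge> 1 \<Longrightarrow> sets (\<mu>s n) = sets borel"
    and \<mu>: "prob_space \<mu>" "sets \<mu> = sets borel"
    and conv: "weakly_converges \<mu>s \<mu>"
    and h: "continuous_on UNIV h" "\<And>x. 0 \<le> h x"
    and fin_n: "\<And>n. n \<ge> 1 \<Longrightarrow> (\<integral>\<^sup>+ x. ennreal (h x) \<partial>\<mu>s n) < top"
    and fin: "(\<integral>\<^sup>+ x. ennreal (h x) \<partial>\<mu>) < top"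
    and lim: "(\<lambda>n. \<integral>\<^sup>+ x. ennreal (h x) \<partial>\<mu>s n) \<longlonglongrightarrow> (\<integral>\<^sup>+ x. ennreal (h x) \<partial>\<mu>)"
  shows "(\<lambda>n. \<integral>\<^sup>+ x. ennreal (h x) - of_nat N \<partial>\<mu>s n)
    \<longlonglongrightarrow> (\<integral>\<^sup>+ x. ennreal (h x) - of_nat N \<partial>\<mu>)"
proof -
  have meas: "(\<lambda>x. ennreal (h x)) \<in> borel_measurable M" if "sets M = sets borel" for M
    using borel_measurable_continuous_onI[OF h(1)] that by (simp cong: measurable_cong_sets)
  have "(\<lambda>n. (\<integral>\<^sup>+ x. ennreal (h x) \<partial>\<mu>s n) - (\<integral>\<^sup>+ x. min (ennreal (h x)) (of_nat N) \<partial>\<mu>s n))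
    \<longlonglongrightarrow> (\<integral>\<^sup>+ x. ennreal (h x) \<partial>\<mu>) - (\<integral>\<^sup>+ x. min (ennreal (h x)) (of_nat N) \<partial>\<mu>)"
    using fin
    by (intro tendsto_diff_ennreal_general lim weakly_converges_nn_integral_min[OF \<mu>s \<mu> conv h]) auto
  moreover have "eventually (\<lambda>n. (\<integral>\<^sup>+ x. ennreal (h x) \<partial>\<mu>s n) - (\<integral>\<^sup>+ x. min (ennreal (h x)) (of_nat N) \<partial>\<mu>s n)
      = (\<integral>\<^sup>+ x. ennreal (h x) - of_nat N \<partial>\<mu>s n)) sequentially"
    using eventually_ge_at_top[of 1]
    by eventually_elim (rule nn_integral_excess[symmetric, OF meas[OF \<mu>s(2)] fin_n])
  ultimately show ?thesis
    by (subst nn_integral_excess[OF meas[OF \<mu>(2)] fin]) (rule Lim_transform_eventually)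
qed

section \<open>Cost functions with the doubling property\<close>

locale doubling_cost =
  fixes C :: "real \<Rightarrow> real" and K :: real
  assumes C_range: "C \<in> {0..} \<rightarrow> {0..}" and C_mono_on: "mono_on {0..} C"
    and C_cont: "continuous_on {0..} C" and C_0: "C 0 = 0"
    and C_nontrivial: "\<exists>y\<ge>0. C y \<noteq> 0"
    and K_pos: "K > 0" and doubling: "\<And>y. y \<ge> 0 \<Longrightarrow> C (2 * y) \<le> K * C y"
begin

lemma C_nonneg: "0 \<le> y \<Longrightarrow> 0 \<le> C y"
  using C_range by auto

lemma C_mono: "0 \<le> x \<Longrightarrow> x \<le> y \<Longrightarrow> C x \<le> C y"
  using C_mono_on by (auto simp: mono_on_def)

text \<open>
  If \<open>C\<close> vanished at some \<open>y > 0\<close>, doubling would carry this to all \<open>2 ^ n * y\<close>, and monotonicity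
  to the whole half-line.
\<close>

lemma C_pos:
  assumes "y > 0"
  shows "C y > 0"
proof (rule ccontr)
  assume "\<not> C y > 0"
  then have 0: "C y = 0" using C_nonneg[of y] assms by simp
  have iter: "C (2 ^ n * y) = 0" for n
  proof (induction n)
    case (Suc n)
    then have "C (2 ^ Suc n * y) \<le> 0" using doubling[of "2 ^ n * y"] assms by (simp add: mult.assoc)
    moreover have "C (2 ^ Suc n * y) \<ge> 0" using assms by (intro C_nonneg) simp
    ultimately show ?case by simp
  qed (simp add: 0)
  obtain z where z: "z \<ge> 0" "C z \<noteq> 0" using C_nontrivial by auto
  obtain n :: nat where "z / y < 2 ^ n" using real_arch_pow[of 2 "z / y"] by auto
  then have "z \<le> 2 ^ n * y" using assms by (simp add: field_simps)
  from C_mono[OF z(1) this] iter[of n] C_nonneg[OF z(1)] z(2) show False by simp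
qed

text \<open>
  Doubling gives subadditivity up to the factor \<open>K\<close>, because \<open>x + y \<le> 2 * max x y\<close>.
\<close>

lemma C_add:
  assumes "0 \<le> x" "0 \<le> y"
  shows "C (x + y) \<le> K * C x + K * C y"
proof -
  have "C (x + y) \<le> C (2 * max x y)" using assms by (intro C_mono) auto
  also have "\<dots> \<le> K * C (max x y)" using assms by (intro doubling) auto
  also have "\<dots> \<le> K * C x + K * C y"
    using C_nonneg[OF assms(1)] C_nonneg[OF assms(2)] K_pos by (auto simp: max_def)
  finally show ?thesis .
qed

lemma C_dist_triangle:
  fixes x y a :: "'a::metric_space"
  shows "C (dist x a) \<le> K * C (dist x y) + K * C (dist y a)"
  by (rule order_trans[OF C_mono[OF _ dist_triangle] C_add]) auto

lemma C_small:
  assumes "e > 0"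
  obtains d where "d > 0" "C d < e"
proof -
  obtain d where d: "d > 0" "\<And>x. x \<ge> 0 \<Longrightarrow> dist x 0 < d \<Longrightarrow> dist (C x) (C 0) < e"
    using C_cont assms unfolding continuous_on_iff by (metis atLeast_iff order_refl)
  have "C (d / 2) < e" using d(2)[of "d / 2"] d(1) by (simp add: C_0)
  with d(1) show thesis by (intro that[of "d / 2"]) auto
qed

lemma continuous_C_dist:
  fixes f g :: "'b::topological_space \<Rightarrow> 'a::metric_space"
  assumes "continuous_on UNIV f" "continuous_on UNIV g"
  shows "continuous_on UNIV (\<lambda>x. C (dist (f x) (g x)))"
  by (rule continuous_on_compose2[OF C_cont]) (auto intro!: continuous_intros assms)

lemma C_dist_nonneg [simp]: "0 \<le> C (dist x y)" by (rule C_nonneg) simp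

lemma moment_measurable:
  fixes a :: "'a::metric_space"
  assumes "sets M = sets borel"
  shows "(\<lambda>x. C (dist x a)) \<in> borel_measurable M"
proof -
  have "(\<lambda>x. C (dist x a)) \<in> borel_measurable borel"
    by (intro borel_measurable_continuous_onI continuous_C_dist continuous_intros)
  then show ?thesis using assms by (simp cong: measurable_cong_sets)
qed

lemma cost_measurable:
  fixes \<pi> :: "('a::metric_space \<times> 'a) measure"
  assumes "sets \<pi> = sets borel"
  shows "(\<lambda>z. C (dist (fst z) (snd z))) \<in> borel_measurable \<pi>"
proof -
  have "(\<lambda>z::'a\<times>'a. C (dist (fst z) (snd z))) \<in> borel_measurable borel"
    by (intro borel_measurable_continuous_onI continuous_C_dist continuous_intros)
  then show ?thesis using assms by (simp cong: measurable_cong_sets)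
qed

lemma doubled_moment_le:
  fixes a :: "'a::metric_space"
  assumes "sets M = sets borel"
  shows "(\<integral>\<^sup>+ x. ennreal (C (2 * dist x a)) \<partial>M) \<le> ennreal K * (\<integral>\<^sup>+ x. ennreal (C (dist x a)) \<partial>M)"
proof -
  have "(\<integral>\<^sup>+ x. ennreal (C (2 * dist x a)) \<partial>M) \<le> (\<integral>\<^sup>+ x. ennreal K * ennreal (C (dist x a)) \<partial>M)"
    using K_pos by (intro nn_integral_mono) (simp add: ennreal_mult[symmetric] doubling ennreal_leI)
  also have "\<dots> = ennreal K * (\<integral>\<^sup>+ x. ennreal (C (dist x a)) \<partial>M)"
    using moment_measurable[OF assms] by (intro nn_integral_cmult) auto
  finally show ?thesis .
qed

lemma doubled_moment_finite_iff:
  fixes a :: "'a::metric_space"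
  assumes "sets M = sets borel"
  shows "(\<integral>\<^sup>+ x. ennreal (C (2 * dist x a)) \<partial>M) < top \<longleftrightarrow> (\<integral>\<^sup>+ x. ennreal (C (dist x a)) \<partial>M) < top"
proof
  assume "(\<integral>\<^sup>+ x. ennreal (C (2 * dist x a)) \<partial>M) < top"
  moreover have "(\<integral>\<^sup>+ x. ennreal (C (dist x a)) \<partial>M) \<le> (\<integral>\<^sup>+ x. ennreal (C (2 * dist x a)) \<partial>M)"
    by (intro nn_integral_mono ennreal_leI C_mono) auto
  ultimately show "(\<integral>\<^sup>+ x. ennreal (C (dist x a)) \<partial>M) < top" by (rule order_le_less_trans[rotated])
next
  assume "(\<integral>\<^sup>+ x. ennreal (C (dist x a)) \<partial>M) < top"
  then have "ennreal K * (\<integral>\<^sup>+ x. ennreal (C (dist x a)) \<partial>M) < top"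
    by (simp add: ennreal_mult_less_top)
  then show "(\<integral>\<^sup>+ x. ennreal (C (2 * dist x a)) \<partial>M) < top"
    using doubled_moment_le[OF assms] by (rule order_le_less_trans[rotated])
qed

end

section \<open>Consequences of a coupling with small cost\<close>

lemma couplings_measurable:
  fixes \<pi> :: "('a::second_countable_topology \<times> 'a) measure"
  assumes "\<pi> \<in> couplings \<mu> \<nu>"
  shows "fst \<in> measurable \<pi> borel" "snd \<in> measurable \<pi> borel"
proof -
  have "sets \<pi> = sets (borel \<Otimes>\<^sub>M borel)"
    using assms unfolding borel_prod by (simp add: couplings_def)
  then show "fst \<in> measurable \<pi> borel" "snd \<in> measurable \<pi> borel"
    by (simp_all cong: measurable_cong_sets)
qed

lemma couplings_nn_integral:
  fixes \<pi> :: "('a::second_countable_topology \<times> 'a) measure"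
  assumes \<pi>: "\<pi> \<in> couplings \<mu> \<nu>" and h: "h \<in> borel_measurable borel"
  shows "(\<integral>\<^sup>+ x. h x \<partial>\<mu>) = (\<integral>\<^sup>+ z. h (fst z) \<partial>\<pi>)" "(\<integral>\<^sup>+ y. h y \<partial>\<nu>) = (\<integral>\<^sup>+ z. h (snd z) \<partial>\<pi>)"
proof -
  have D: "distr \<pi> borel fst = \<mu>" "distr \<pi> borel snd = \<nu>"
    using \<pi> by (auto simp: couplings_def)
  note [measurable] = couplings_measurable[OF \<pi>]
  show "(\<integral>\<^sup>+ x. h x \<partial>\<mu>) = (\<integral>\<^sup>+ z. h (fst z) \<partial>\<pi>)" "(\<integral>\<^sup>+ y. h y \<partial>\<nu>) = (\<integral>\<^sup>+ z. h (snd z) \<partial>\<pi>)"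
    unfolding D[symmetric] using h by (simp_all add: nn_integral_distr)
qed

text \<open>
  For each fixed \<open>x\<close> the two conditions on \<open>y\<close> are open, and a union of open sets is open; this
  makes the set measurable although the quantifier ranges over uncountably many \<open>x\<close>.
\<close>

lemma open_modulus_violation:
  fixes f :: "'a::metric_space \<Rightarrow> real"
  assumes f: "continuous_on UNIV f"
  shows "open {y. \<exists>x. dist x y < \<delta> \<and> \<bar>f x - f y\<bar> > \<epsilon>}"
proof -
  have "{y. \<exists>x. dist x y < \<delta> \<and> \<bar>f x - f y\<bar> > \<epsilon>} = (\<Union>x. {y. dist x y < \<delta> \<and> \<bar>f x - f y\<bar> > \<epsilon>})"
    by auto
  moreover have "open {y. dist x y < \<delta> \<and> \<bar>f x - f y\<bar> > \<epsilon>}" for x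
    by (intro open_Collect_conj open_Collect_less continuous_intros f)
  ultimately show ?thesis by auto
qed

text \<open>
  A coupled pair \<open>(x, y)\<close> with \<open>dist x y < \<delta>\<close> satisfies \<open>\<bar>f x - f y\<bar> \<le> \<epsilon>\<close>, unless \<open>y\<close> is a point
  where \<open>\<delta>\<close> violates the modulus of continuity \<open>\<epsilon>\<close>. The latter event concerns \<open>\<nu>\<close> alone, so
  its probability is the same for all couplings with this second marginal.
\<close>

lemma coupling_integral_diff_le:
  fixes \<mu> \<nu> :: "'a::{metric_space, second_countable_topology} measure" and f :: "'a \<Rightarrow> real"
  assumes \<pi>: "\<pi> \<in> couplings \<mu> \<nu>" and f: "continuous_on UNIV f" "\<And>x. \<bar>f x\<bar> \<le> B" and "\<epsilon> \<ge> 0"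
  shows "\<bar>(\<integral>x. f x \<partial>\<mu>) - (\<integral>y. f y \<partial>\<nu>)\<bar> \<le>
    \<epsilon> + 2 * B * (measure \<nu> {y. \<exists>x. dist x y < \<delta> \<and> \<bar>f x - f y\<bar> > \<epsilon>} + measure \<pi> {z. \<delta> \<le> dist (fst z) (snd z)})"
proof -
  interpret prob_space \<pi> using \<pi> by (simp add: couplings_def)
  have setsb: "sets \<pi> = sets borel" and D: "distr \<pi> borel fst = \<mu>" "distr \<pi> borel snd = \<nu>"
    using \<pi> by (auto simp: couplings_def)
  have sp: "space \<pi> = UNIV" using sets_eq_imp_space_eq[OF setsb] by simp
  note [measurable] = couplings_measurable[OF \<pi>]
  have [measurable]: "f \<in> borel_measurable borel" by (rule borel_measurable_continuous_onI[OF f(1)])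
  let ?bad = "{y. \<exists>x. dist x y < \<delta> \<and> \<bar>f x - f y\<bar> > \<epsilon>}" and ?far = "{z. \<delta> \<le> dist (fst z) (snd z)}"
  have bad[measurable]: "?bad \<in> sets borel"
    by (intro borel_open open_modulus_violation f)
  have "closed (?far :: ('a \<times> 'a) set)" by (intro closed_Collect_le continuous_intros)
  then have far[measurable]: "?far \<in> sets \<pi>" using setsb by auto
  have B: "B \<ge> 0" using f(2)[of undefined] by linarith
  have int: "integrable \<pi> (\<lambda>z. f (fst z))" "integrable \<pi> (\<lambda>z. f (snd z))"
    by (rule integrable_const_bound[where B=B]; use f(2) in simp)+
  let ?S = "(\<lambda>z. snd z) -` ?bad \<inter> space \<pi>"
  have S[measurable]: "?S \<in> sets \<pi>" by measurable
  have "\<bar>(\<integral>x. f x \<partial>\<mu>) - (\<integral>y. f y \<partial>\<nu>)\<bar> = \<bar>\<integral>z. f (fst z) - f (snd z) \<partial>\<pi>\<bar>"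
    unfolding D[symmetric] by (simp add: integral_distr int)
  also have "\<dots> \<le> (\<integral>z. \<epsilon> + 2 * B * (indicator ?S z + indicator ?far z) \<partial>\<pi>)"
  proof (rule order_trans[OF integral_abs_bound integral_mono])
    show "integrable \<pi> (\<lambda>z. \<bar>f (fst z) - f (snd z)\<bar>)" using int by simp
    show "integrable \<pi> (\<lambda>z. \<epsilon> + 2 * B * (indicator ?S z + indicator ?far z))"
      by (intro Bochner_Integration.integrable_add integrable_mult_right integrable_const
          integrable_real_indicator S far) (simp_all add: emeasure_eq_measure)
    fix z
    have "\<bar>f (fst z) - f (snd z)\<bar> \<le> 2 * B"
      using f(2)[of "fst z"] f(2)[of "snd z"] by linarith
    then show "\<bar>f (fst z) - f (snd z)\<bar> \<le> \<epsilon> + 2 * B * (indicator ?S z + indicator ?far z)"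
      using B \<open>\<epsilon> \<ge> 0\<close> by (auto simp: indicator_def sp not_le not_less dest: spec[of _ "fst z"])
  qed
  also have "\<dots> = \<epsilon> + 2 * B * (measure \<pi> ?S + measure \<pi> ?far)"
    using S far prob_space by (simp add: emeasure_eq_measure)
  also have "measure \<pi> ?S = measure \<nu> ?bad"
    unfolding D(2)[symmetric] by (subst measure_distr) auto
  finally show ?thesis .
qed

context doubling_cost
begin

text \<open>
  Markov's inequality for \<open>C (dist x y)\<close>, which is at least \<open>C \<delta> > 0\<close> on the far pairs.
\<close>

lemma coupling_far_le:
  fixes \<pi> :: "('a::metric_space \<times> 'a) measure"
  assumes "prob_space \<pi>" and sets: "sets \<pi> = sets borel" and \<delta>: "\<delta> > 0" and "\<eta> > 0"
    and cost: "(\<integral>\<^sup>+ (x, y). ennreal (C (dist x y)) \<partial>\<pi>) < ennreal \<eta>"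
  shows "measure \<pi> {z. \<delta> \<le> dist (fst z) (snd z)} \<le> \<eta> / C \<delta>"
proof -
  interpret prob_space \<pi> by fact
  let ?far = "{z::'a\<times>'a. \<delta> \<le> dist (fst z) (snd z)}"
  have "closed ?far" by (intro closed_Collect_le continuous_intros)
  then have far[measurable]: "?far \<in> sets \<pi>" using sets by auto
  have "ennreal (C \<delta> * measure \<pi> ?far) = (\<integral>\<^sup>+ z. ennreal (C \<delta>) * indicator ?far z \<partial>\<pi>)"
    using C_pos[OF \<delta>] by (simp add: nn_integral_cmult_indicator emeasure_eq_measure ennreal_mult)
  also have "\<dots> \<le> (\<integral>\<^sup>+ z. ennreal (C (dist (fst z) (snd z))) \<partial>\<pi>)"
    using \<delta> by (intro nn_integral_mono) (auto simp: indicator_def intro!: ennreal_leI C_mono)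
  also have "\<dots> < ennreal \<eta>" using cost by (simp add: case_prod_unfold)
  finally have "C \<delta> * measure \<pi> ?far < \<eta>" using C_pos[OF \<delta>] by (subst (asm) ennreal_less_iff) auto
  then show ?thesis using C_pos[OF \<delta>] by (simp add: field_simps)
qed

text \<open>
  The limit \<open>\<mu>\<close> is the second marginal of all couplings involved. Hence \<open>\<delta>\<close> can be chosen once,
  from the continuity of the measure \<open>\<mu>\<close> along the violation sets, which decrease to the
  empty set; then a small transport cost makes pairs at distance \<open>\<delta>\<close> or more rare.
\<close>

lemma transport_convergence_imp_weak:
  fixes \<mu>s :: "nat \<Rightarrow> 'a::{metric_space, second_countable_topology} measure"
  assumes \<mu>: "prob_space \<mu>" "sets \<mu> = sets borel"
    and lim: "(\<lambda>n. transport_dist (\<lambda>x y. C (dist x y)) (\<mu>s n) \<mu>) \<longlonglongrightarrow> 0"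
  shows "weakly_converges \<mu>s \<mu>"
  unfolding weakly_converges_def
proof (intro allI impI)
  fix f :: "'a \<Rightarrow> real"
  assume f: "continuous_on UNIV f" and "bounded (range f)"
  then obtain B where B: "B > 0" "\<And>x. \<bar>f x\<bar> \<le> B" by (auto simp: bounded_pos)
  interpret prob_space \<mu> by fact
  define bad where "bad e d = {y. \<exists>x. dist x y < d \<and> \<bar>f x - f y\<bar> > e}" for e d :: real
  show "(\<lambda>n. \<integral>x. f x \<partial>\<mu>s n) \<longlonglongrightarrow> (\<integral>x. f x \<partial>\<mu>)"
  proof (rule tendstoI)
    fix e :: real assume "e > 0"
    define \<epsilon> where "\<epsilon> = e / 3"
    have \<epsilon>: "\<epsilon> > 0" using \<open>e > 0\<close> by (simp add: \<epsilon>_def)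
    have "(\<lambda>m. measure \<mu> (bad \<epsilon> (1 / Suc m))) \<longlonglongrightarrow> measure \<mu> (\<Inter>m. bad \<epsilon> (1 / Suc m))"
    proof (rule finite_Lim_measure_decseq)
      show "range (\<lambda>m. bad \<epsilon> (1 / Suc m)) \<subseteq> sets \<mu>"
        using open_modulus_violation[OF f] \<mu>(2) by (auto simp: bad_def)
      show "decseq (\<lambda>m. bad \<epsilon> (1 / Suc m))"
      proof (rule decseq_SucI)
        fix m
        have "1 / real (Suc (Suc m)) \<le> 1 / real (Suc m)" by (simp add: field_simps)
        then show "bad \<epsilon> (1 / Suc (Suc m)) \<subseteq> bad \<epsilon> (1 / Suc m)"
          unfolding bad_def using less_le_trans[of "dist _ _"] by blast
      qed
    qed
    moreover have "(\<Inter>m. bad \<epsilon> (1 / Suc m)) = {}"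
    proof (rule equals0I)
      fix y assume y: "y \<in> (\<Inter>m. bad \<epsilon> (1 / Suc m))"
      obtain d where d: "d > 0" "\<And>x. dist x y < d \<Longrightarrow> dist (f x) (f y) < \<epsilon>"
        using f \<epsilon> unfolding continuous_on_iff by (metis UNIV_I)
      obtain m where "1 / real (Suc m) < d" using nat_approx_posE[OF d(1)] by metis
      moreover obtain x where "dist x y < 1 / Suc m" "\<bar>f x - f y\<bar> > \<epsilon>"
        using y by (auto simp: bad_def)
      ultimately show False using d(2)[of x] by (simp add: dist_real_def)
    qed
    ultimately have "(\<lambda>m. measure \<mu> (bad \<epsilon> (1 / Suc m))) \<longlonglongrightarrow> 0" by simp
    then have "eventually (\<lambda>m. measure \<mu> (bad \<epsilon> (1 / Suc m)) < \<epsilon> / (2 * B)) sequentially"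
      using \<epsilon> B by (intro order_tendstoD) auto
    then obtain m where m: "measure \<mu> (bad \<epsilon> (1 / Suc m)) < \<epsilon> / (2 * B)"
      by (auto simp: eventually_sequentially)
    define \<delta> where "\<delta> = 1 / real (Suc m)"
    have \<delta>: "\<delta> > 0" by (simp add: \<delta>_def)
    \<comment> \<open>a cost below this value makes far pairs as rare as the violation set\<close>
    define \<eta> where "\<eta> = C \<delta> * (\<epsilon> / (2 * B))"
    have \<eta>: "\<eta> > 0" using C_pos[OF \<delta>] \<epsilon> B by (simp add: \<eta>_def)
    have "eventually (\<lambda>n. transport_dist (\<lambda>x y. C (dist x y)) (\<mu>s n) \<mu> < ennreal \<eta>) sequentially"
      using \<eta> by (intro order_tendstoD(2)[OF lim]) simp
    then show "eventually (\<lambda>n. dist (\<integral>x. f x \<partial>\<mu>s n) (\<integral>x. f x \<partial>\<mu>) < e) sequentially"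
    proof eventually_elim
      case (elim n)
      then obtain \<pi> where \<pi>: "\<pi> \<in> couplings (\<mu>s n) \<mu>"
          and cost: "(\<integral>\<^sup>+ (x, y). ennreal (C (dist x y)) \<partial>\<pi>) < ennreal \<eta>"
        unfolding transport_dist_def by (auto simp: INF_less_iff)
      have far: "measure \<pi> {z. \<delta> \<le> dist (fst z) (snd z)} \<le> \<epsilon> / (2 * B)"
        using coupling_far_le[OF _ _ \<delta> \<eta> cost] \<pi> C_pos[OF \<delta>] by (simp add: couplings_def \<eta>_def)
      have "\<bar>(\<integral>x. f x \<partial>\<mu>s n) - (\<integral>x. f x \<partial>\<mu>)\<bar>
          \<le> \<epsilon> + 2 * B * (measure \<mu> (bad \<epsilon> \<delta>) + measure \<pi> {z. \<delta> \<le> dist (fst z) (snd z)})"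
        unfolding bad_def by (rule coupling_integral_diff_le[OF \<pi> f B(2)]) (use \<epsilon> in simp)
      also have "\<dots> < \<epsilon> + 2 * B * (\<epsilon> / (2 * B) + \<epsilon> / (2 * B))"
        using m far B by (intro add_strict_left_mono mult_strict_left_mono add_less_le_mono) (auto simp: \<delta>_def)
      also have "\<dots> = e" using B by (simp add: \<epsilon>_def field_simps)
      finally show ?case by (simp add: dist_real_def)
    qed
  qed
qed

text \<open>
  This is the uniform integrability hidden in small transport cost: the excess of the moment
  under \<open>\<mu>\<close> is controlled by the cost and by an excess under \<open>\<nu>\<close> alone. It is the
  subadditivity of \<open>C\<close>, with the level \<open>R\<close> subtracted on both sides.
\<close>

lemma excess_moment_le:
  fixes a :: "'a::{metric_space, second_countable_topology}"
  assumes sets_\<mu>: "sets \<mu> = sets borel" and sets_\<nu>: "sets \<nu> = sets borel"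
  shows "(\<integral>\<^sup>+ x. ennreal (C (dist x a)) - R \<partial>\<mu>) \<le>
    ennreal K * transport_dist (\<lambda>x y. C (dist x y)) \<mu> \<nu> + (\<integral>\<^sup>+ y. ennreal (K * C (dist y a)) - R \<partial>\<nu>)"
    (is "?X \<le> ennreal K * ?T + ?Y")
proof -
  have meas[measurable]: "(\<lambda>x. C (dist x a)) \<in> borel_measurable borel"
    by (rule moment_measurable) simp
  have each: "?X \<le> ennreal K * (\<integral>\<^sup>+ (x, y). ennreal (C (dist x y)) \<partial>\<pi>) + ?Y"
    if \<pi>: "\<pi> \<in> couplings \<mu> \<nu>" for \<pi>
  proof -
    have setsb: "sets \<pi> = sets borel" using \<pi> by (simp add: couplings_def)
    note [measurable] = couplings_measurable[OF \<pi>]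
    have [measurable]: "(\<lambda>z. C (dist (fst z) (snd z))) \<in> borel_measurable \<pi>"
      by (rule cost_measurable[OF setsb])
    have "?X = (\<integral>\<^sup>+ z. ennreal (C (dist (fst z) a)) - R \<partial>\<pi>)"
      by (rule couplings_nn_integral(1)[OF \<pi>]) measurable
    also have "\<dots> \<le> (\<integral>\<^sup>+ z. ennreal K * ennreal (C (dist (fst z) (snd z)))
        + (ennreal (K * C (dist (snd z) a)) - R) \<partial>\<pi>)"
    proof (rule nn_integral_mono)
      fix z :: "'a \<times> 'a"
      have "ennreal (C (dist (fst z) a)) \<le> ennreal (K * C (dist (fst z) (snd z)) + K * C (dist (snd z) a))"
        by (intro ennreal_leI C_dist_triangle)
      also have "\<dots> = ennreal K * ennreal (C (dist (fst z) (snd z))) + ennreal (K * C (dist (snd z) a))"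
        using K_pos by (simp add: ennreal_plus ennreal_mult)
      finally show "ennreal (C (dist (fst z) a)) - R
          \<le> ennreal K * ennreal (C (dist (fst z) (snd z))) + (ennreal (K * C (dist (snd z) a)) - R)"
        by (rule order_trans[OF ennreal_minus_mono[OF _ order_refl] add_diff_le_ennreal])
    qed
    also have "\<dots> = ennreal K * (\<integral>\<^sup>+ z. ennreal (C (dist (fst z) (snd z))) \<partial>\<pi>)
        + (\<integral>\<^sup>+ z. ennreal (K * C (dist (snd z) a)) - R \<partial>\<pi>)"
      by (simp add: nn_integral_add nn_integral_cmult)
    also have "(\<integral>\<^sup>+ z. ennreal (K * C (dist (snd z) a)) - R \<partial>\<pi>) = ?Y"
      by (rule couplings_nn_integral(2)[OF \<pi>, symmetric]) measurable
    finally show ?thesis by (simp add: case_prod_unfold)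
  qed
  show ?thesis
  proof (cases "?Y = top")
    case False
    \<comment> \<open>the estimate is solved for the cost, since only then the infimum can be taken\<close>
    have "(?X - ?Y) / ennreal K \<le> ?T"
      unfolding transport_dist_def
    proof (rule INF_greatest)
      fix \<pi> assume "\<pi> \<in> couplings \<mu> \<nu>"
      from each[OF this]
      have "?X - ?Y \<le> ennreal K * (\<integral>\<^sup>+ (x, y). ennreal (C (dist x y)) \<partial>\<pi>)"
        using False by (simp add: ennreal_minus_le_iff add.commute)
      then have "(?X - ?Y) / ennreal K \<le> (\<integral>\<^sup>+ (x, y). ennreal (C (dist x y)) \<partial>\<pi>) * ennreal K / ennreal K"
        by (intro divide_right_mono_ennreal) (simp add: mult.commute)
      then show "(?X - ?Y) / ennreal K \<le> (\<integral>\<^sup>+ (x, y). ennreal (C (dist x y)) \<partial>\<pi>)"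
        using K_pos by (simp add: ennreal_mult_divide_eq)
    qed
    from mult_left_mono[OF this, of "ennreal K"]
    have "?X - ?Y \<le> ennreal K * ?T"
      using K_pos by (simp add: ennreal_times_divide mult.commute[of "ennreal K"] ennreal_mult_divide_eq)
    then show ?thesis using False by (simp add: ennreal_minus_le_iff add.commute)
  qed simp
qed

text \<open>
  Truncated moments converge by weak convergence, which settles the lower bound by monotone
  convergence. For the upper bound, the excess over a level \<open>N\<close> is, up to the vanishing cost, at
  most an excess under \<open>\<mu>\<close>, which is small for large \<open>N\<close>.
\<close>

lemma transport_convergence_imp_moments:
  fixes \<mu>s :: "nat \<Rightarrow> 'a::{metric_space, second_countable_topology} measure" and a :: 'a
  assumes \<mu>s: "\<And>n. n \<ge> 1 \<Longrightarrow> prob_space (\<mu>s n)" "\<And>n. n \<ge> 1 \<Longrightarrow> sets (\<mu>s n) = sets borel"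
    and \<mu>: "prob_space \<mu>" "sets \<mu> = sets borel"
    and fin: "(\<integral>\<^sup>+ x. ennreal (C (dist x a)) \<partial>\<mu>) < top"
    and lim: "(\<lambda>n. transport_dist (\<lambda>x y. C (dist x y)) (\<mu>s n) \<mu>) \<longlonglongrightarrow> 0"
  shows "(\<lambda>n. \<integral>\<^sup>+ x. ennreal (C (dist x a)) \<partial>\<mu>s n) \<longlonglongrightarrow> (\<integral>\<^sup>+ x. ennreal (C (dist x a)) \<partial>\<mu>)"
proof -
  define L where "L = (\<integral>\<^sup>+ x. ennreal (C (dist x a)) \<partial>\<mu>)"
  have meas: "(\<lambda>x. ennreal (C (dist x a))) \<in> borel_measurable M"
      "(\<lambda>x. ennreal (K * C (dist x a))) \<in> borel_measurable M" if "sets M = sets borel" for M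
    using moment_measurable[OF that, of a] by simp_all
  let ?m = "\<lambda>N M. \<integral>\<^sup>+ x. min (ennreal (C (dist x a))) (of_nat N) \<partial>M"
  have min_lim: "(\<lambda>n. ?m N (\<mu>s n)) \<longlonglongrightarrow> ?m N \<mu>" for N
    by (rule weakly_converges_nn_integral_min[OF \<mu>s \<mu> transport_convergence_imp_weak[OF \<mu> lim]])
      (auto intro!: continuous_C_dist continuous_intros)
  have "(\<lambda>n. \<integral>\<^sup>+ x. ennreal (C (dist x a)) \<partial>\<mu>s n) \<longlonglongrightarrow> L"
  proof (rule order_tendstoI)
    fix l assume "l < L"
    then have "eventually (\<lambda>N. l < ?m N \<mu>) sequentially"
      unfolding L_def by (intro order_tendstoD(1)[OF nn_integral_min_tendsto] meas \<mu>)
    then obtain N where "l < ?m N \<mu>" by (auto simp: eventually_sequentially)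
    from order_tendstoD(1)[OF min_lim this]
    show "eventually (\<lambda>n. l < (\<integral>\<^sup>+ x. ennreal (C (dist x a)) \<partial>\<mu>s n)) sequentially"
      by eventually_elim (erule less_le_trans, intro nn_integral_mono, simp)
  next
    fix u assume "L < u"
    let ?Z = "\<lambda>N::nat. \<integral>\<^sup>+ x. ennreal (K * C (dist x a)) - of_nat N \<partial>\<mu>"
    have "(\<integral>\<^sup>+ x. ennreal (K * C (dist x a)) \<partial>\<mu>) = ennreal K * L"
      unfolding L_def using K_pos meas[OF \<mu>(2)] by (simp add: ennreal_mult nn_integral_cmult)
    then have "?Z \<longlonglongrightarrow> 0"
      using fin by (intro nn_integral_excess_tendsto_0 meas \<mu>) (simp add: L_def ennreal_mult_less_top)
    from tendsto_add[OF tendsto_const this, of L]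
    have "eventually (\<lambda>N. L + ?Z N < u) sequentially"
      using \<open>L < u\<close> by (intro order_tendstoD) auto
    then obtain N where N: "L + ?Z N < u" by (auto simp: eventually_sequentially)
    have "(\<lambda>n. ?m N (\<mu>s n) + (ennreal K * transport_dist (\<lambda>x y. C (dist x y)) (\<mu>s n) \<mu> + ?Z N))
        \<longlonglongrightarrow> ?m N \<mu> + (ennreal K * 0 + ?Z N)"
      by (intro tendsto_add min_lim ennreal_tendsto_cmult lim tendsto_const) simp
    moreover have "?m N \<mu> + (ennreal K * 0 + ?Z N) < u"
      using N by (intro le_less_trans[OF _ N]) (auto simp: L_def intro!: add_right_mono nn_integral_mono)
    ultimately have "eventually (\<lambda>n. ?m N (\<mu>s n)
        + (ennreal K * transport_dist (\<lambda>x y. C (dist x y)) (\<mu>s n) \<mu> + ?Z N) < u) sequentially"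
      by (rule order_tendstoD(2))
    with eventually_ge_at_top[of 1]
    show "eventually (\<lambda>n. (\<integral>\<^sup>+ x. ennreal (C (dist x a)) \<partial>\<mu>s n) < u) sequentially"
    proof eventually_elim
      case (elim n)
      have "(\<integral>\<^sup>+ x. ennreal (C (dist x a)) \<partial>\<mu>s n)
          = ?m N (\<mu>s n) + (\<integral>\<^sup>+ x. ennreal (C (dist x a)) - of_nat N \<partial>\<mu>s n)"
        by (rule nn_integral_split_min[OF meas(1)[OF \<mu>s(2)[OF elim(1)]]])
      also have "\<dots> \<le> ?m N (\<mu>s n) + (ennreal K * transport_dist (\<lambda>x y. C (dist x y)) (\<mu>s n) \<mu> + ?Z N)"
        by (intro add_left_mono excess_moment_le \<mu>s(2)[OF elim(1)] \<mu>(2))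
      also have "\<dots> < u" by (rule elim(2))
      finally show ?case .
    qed
  qed
  then show ?thesis by (simp add: L_def)
qed

section \<open>Weak convergence with convergent moments\<close>

text \<open>
  In the bound \<open>transport_dist_le\<close>, with \<open>G x = K * C (dist x a)\<close>, every quantity that depends on
  \<open>n\<close> converges: the masses of the functions \<open>\<phi> i\<close> by weak convergence, the excess by the
  convergence of moments. The limiting bound is small if the parameters are chosen in the
  order \<open>\<epsilon>\<close> (diameter of the supports), \<open>N\<close> (truncation level), \<open>k\<close> (number of functions).
\<close>

lemma weak_and_moments_imp_transport_convergence:
  fixes \<mu>s :: "nat \<Rightarrow> 'a::{metric_space, second_countable_topology} measure" and a :: 'a
  assumes \<mu>s: "\<And>n. n \<ge> 1 \<Longrightarrow> prob_space (\<mu>s n)" "\<And>n. n \<ge> 1 \<Longrightarrow> sets (\<mu>s n) = sets borel"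
    and \<mu>: "prob_space \<mu>" "sets \<mu> = sets borel"
    and fin_n: "\<And>n. n \<ge> 1 \<Longrightarrow> (\<integral>\<^sup>+ x. ennreal (C (dist x a)) \<partial>\<mu>s n) < top"
    and fin: "(\<integral>\<^sup>+ x. ennreal (C (dist x a)) \<partial>\<mu>) < top"
    and weak: "weakly_converges \<mu>s \<mu>"
    and moments: "(\<lambda>n. \<integral>\<^sup>+ x. ennreal (C (dist x a)) \<partial>\<mu>s n) \<longlonglongrightarrow> (\<integral>\<^sup>+ x. ennreal (C (dist x a)) \<partial>\<mu>)"
  shows "(\<lambda>n. transport_dist (\<lambda>x y. C (dist x y)) (\<mu>s n) \<mu>) \<longlonglongrightarrow> 0"
proof (rule order_tendstoI)
  fix e :: ennreal assume "0 < e"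
  interpret prob_space \<mu> by fact
  obtain r where r: "ennreal r < e" "r > 0"
  proof -
    obtain q where q: "0 < q" "q < e" using dense[OF \<open>0 < e\<close>] by auto
    then have "q < top" by (auto intro: less_le_trans)
    then show thesis using q that[of "enn2real q"] by (auto simp: enn2real_positive_iff)
  qed
  define h where "h x = K * C (dist x a)" for x
  define G where "G x = ennreal (h x)" for x
  have h_cont: "continuous_on UNIV h"
    unfolding h_def by (intro continuous_intros continuous_C_dist)
  have h_nonneg: "0 \<le> h x" for x using K_pos by (simp add: h_def)
  have G_eq: "(\<integral>\<^sup>+ x. G x \<partial>M) = ennreal K * (\<integral>\<^sup>+ x. ennreal (C (dist x a)) \<partial>M)"
    if "sets M = sets borel" for M
    using moment_measurable[OF that, of a] K_pos
    by (simp add: G_def h_def ennreal_mult nn_integral_cmult)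
  have G_meas: "G \<in> borel_measurable M" if "sets M = sets borel" for M
    unfolding G_def h_def using moment_measurable[OF that, of a] by simp
  have G_fin: "(\<integral>\<^sup>+ x. G x \<partial>\<mu>) < top"
    using fin by (simp add: G_eq \<mu> ennreal_mult_less_top)
  have G_fin_n: "(\<integral>\<^sup>+ x. G x \<partial>\<mu>s n) < top" if "n \<ge> 1" for n
    using fin_n[OF that] by (simp add: G_eq[OF \<mu>s(2)[OF that]] ennreal_mult_less_top)
  have "(\<lambda>n. ennreal K * (\<integral>\<^sup>+ x. ennreal (C (dist x a)) \<partial>\<mu>s n)) \<longlonglongrightarrow> (\<integral>\<^sup>+ x. G x \<partial>\<mu>)"
    unfolding G_eq[OF \<mu>(2)] by (intro ennreal_tendsto_cmult moments) simp
  moreover have "eventually (\<lambda>n. ennreal K * (\<integral>\<^sup>+ x. ennreal (C (dist x a)) \<partial>\<mu>s n) = (\<integral>\<^sup>+ x. G x \<partial>\<mu>s n)) sequentially"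
    using eventually_ge_at_top[of 1] by eventually_elim (simp add: G_eq \<mu>s)
  ultimately have G_lim: "(\<lambda>n. \<integral>\<^sup>+ x. G x \<partial>\<mu>s n) \<longlonglongrightarrow> (\<integral>\<^sup>+ x. G x \<partial>\<mu>)"
    by (rule Lim_transform_eventually)
  have excess_lim: "(\<lambda>n. \<integral>\<^sup>+ x. G x - of_nat N \<partial>\<mu>s n) \<longlonglongrightarrow> (\<integral>\<^sup>+ x. G x - of_nat N \<partial>\<mu>)" for N
    unfolding G_def
    by (rule weakly_converges_nn_integral_excess[OF \<mu>s \<mu> weak h_cont h_nonneg])
      (use G_fin G_fin_n G_lim in \<open>simp_all add: G_def\<close>)
  obtain \<epsilon> where \<epsilon>: "\<epsilon> > 0" "C \<epsilon> < r / 4" using C_small[of "r / 4"] r by auto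
  have "eventually (\<lambda>N. (\<integral>\<^sup>+ x. G x - of_nat N \<partial>\<mu>) < ennreal (r / 4)) sequentially"
    using r by (intro order_tendstoD(2)[OF nn_integral_excess_tendsto_0] G_meas \<mu> G_fin) simp
  then obtain N where N: "(\<integral>\<^sup>+ x. G x - of_nat N \<partial>\<mu>) < ennreal (r / 4)"
    by (auto simp: eventually_sequentially)
  obtain \<phi> :: "nat \<Rightarrow> 'a \<Rightarrow> real" where \<phi>: "\<And>i. continuous_on UNIV (\<phi> i)" "\<And>i x. 0 \<le> \<phi> i x"
      "\<And>k x. (\<Sum>i<k. \<phi> i x) \<le> 1" "\<And>x. (\<lambda>i. \<phi> i x) sums 1"
      "\<And>i x y. \<phi> i x > 0 \<Longrightarrow> \<phi> i y > 0 \<Longrightarrow> dist x y < \<epsilon>"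
    using partition_of_unity_small_supports[OF \<epsilon>(1)] by blast
  have \<phi>_meas: "(\<lambda>x. ennreal (\<phi> i x)) \<in> borel_measurable M" if "sets M = sets borel" for i M
    using borel_measurable_continuous_onI[OF \<phi>(1)[of i]] that by (simp cong: measurable_cong_sets)
  have \<phi>_le: "\<phi> i x \<le> 1" for i x
    using \<phi>(3)[of x "Suc i"] sum_nonneg[of "{..<i}" "\<lambda>i. \<phi> i x"] \<phi>(2) by simp
  define p where "p i M = (\<integral>\<^sup>+ x. ennreal (\<phi> i x) \<partial>M)" for i M
  have p_lim: "(\<lambda>n. p i (\<mu>s n)) \<longlonglongrightarrow> p i \<mu>" for i
    unfolding p_def by (rule weakly_converges_nn_integral[OF \<mu>s \<mu> weak \<phi>(1,2) \<phi>_le])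
  \<comment> \<open>the masses of the partition of unity add up to one, so finitely many functions carry almost all of it\<close>
  have "(\<Sum>i. p i \<mu>) = (\<integral>\<^sup>+ x. (\<Sum>i. ennreal (\<phi> i x)) \<partial>\<mu>)"
    unfolding p_def by (rule nn_integral_suminf[symmetric]) (rule \<phi>_meas[OF \<mu>(2)])
  also have "\<dots> = (\<integral>\<^sup>+ x. 1 \<partial>\<mu>)"
    by (simp only: suminf_ennreal_eq[OF \<phi>(2) \<phi>(4)] ennreal_1)
  finally have "(\<Sum>i. p i \<mu>) = 1" by (simp add: emeasure_space_1)
  then have "(\<lambda>k. \<Sum>i<k. p i \<mu>) \<longlonglongrightarrow> 1" using summable_LIMSEQ[of "\<lambda>i. p i \<mu>"] by simp
  then have "(\<lambda>k. 2 * of_nat N * (1 - (\<Sum>i<k. p i \<mu>))) \<longlonglongrightarrow> 2 * of_nat N * (1 - 1)"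
    by (intro ennreal_tendsto_cmult tendsto_diff_ennreal_general tendsto_const)
      (auto simp: ennreal_mult_less_top of_nat_less_top)
  then have "eventually (\<lambda>k. 2 * of_nat N * (1 - (\<Sum>i<k. p i \<mu>)) < ennreal (r / 4)) sequentially"
    using r by (intro order_tendstoD(2)) auto
  then obtain k where k: "2 * of_nat N * (1 - (\<Sum>i<k. p i \<mu>)) < ennreal (r / 4)"
    by (auto simp: eventually_sequentially)
  define bound where "bound n = ennreal (C \<epsilon>)
      + 2 * of_nat N * (1 - (\<Sum>i<k. min (p i (\<mu>s n)) (p i \<mu>)))
      + (\<integral>\<^sup>+ x. G x - of_nat N \<partial>\<mu>s n) + (\<integral>\<^sup>+ x. G x - of_nat N \<partial>\<mu>)" for n
  have "bound \<longlonglongrightarrow> ennreal (C \<epsilon>) + 2 * of_nat N * (1 - (\<Sum>i<k. min (p i \<mu>) (p i \<mu>)))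
      + (\<integral>\<^sup>+ x. G x - of_nat N \<partial>\<mu>) + (\<integral>\<^sup>+ x. G x - of_nat N \<partial>\<mu>)"
    unfolding bound_def
    by (intro tendsto_add tendsto_const excess_lim ennreal_tendsto_cmult tendsto_diff_ennreal_general
        tendsto_sum tendsto_min p_lim) (auto simp: ennreal_mult_less_top of_nat_less_top)
  moreover have "ennreal (C \<epsilon>) + 2 * of_nat N * (1 - (\<Sum>i<k. min (p i \<mu>) (p i \<mu>)))
      + (\<integral>\<^sup>+ x. G x - of_nat N \<partial>\<mu>) + (\<integral>\<^sup>+ x. G x - of_nat N \<partial>\<mu>) < e"
  proof -
    have "ennreal (C \<epsilon>) + 2 * of_nat N * (1 - (\<Sum>i<k. min (p i \<mu>) (p i \<mu>)))
      + (\<integral>\<^sup>+ x. G x - of_nat N \<partial>\<mu>) + (\<integral>\<^sup>+ x. G x - of_nat N \<partial>\<mu>)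
      \<le> ennreal (r / 4) + ennreal (r / 4) + ennreal (r / 4) + ennreal (r / 4)"
      using \<epsilon>(2) k N by (intro add_mono ennreal_leI) auto
    also have "\<dots> = ennreal r" using r by (simp add: ennreal_plus[symmetric] del: ennreal_plus)
    also have "\<dots> < e" by (rule r(1))
    finally show ?thesis .
  qed
  ultimately have "eventually (\<lambda>n. bound n < e) sequentially" by (rule order_tendstoD(2))
  with eventually_ge_at_top[of 1]
  show "eventually (\<lambda>n. transport_dist (\<lambda>x y. C (dist x y)) (\<mu>s n) \<mu> < e) sequentially"
  proof eventually_elim
    case (elim n)
    have "transport_dist (\<lambda>x y. C (dist x y)) (\<mu>s n) \<mu> \<le> bound n"
      unfolding bound_def p_def
    proof (rule transport_dist_le[OF \<mu>s(1)[OF elim(1)] \<mu>s(2)[OF elim(1)] \<mu>])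
      show "(\<lambda>x. ennreal (\<phi> i x)) \<in> borel_measurable borel" for i
        by (rule \<phi>_meas) simp
      show "(\<Sum>i<k. ennreal (\<phi> i x)) \<le> 1" for x
        using \<phi>(2,3) by (simp add: sum_ennreal)
      show "ennreal (C (dist x y)) \<le> ennreal (C \<epsilon>)"
        if "0 < ennreal (\<phi> i x)" "0 < ennreal (\<phi> i y)" for i x y
        using \<phi>(5)[of i x y] that by (intro ennreal_leI C_mono) auto
      show "(\<lambda>(x::'a, y). C (dist x y)) \<in> borel_measurable borel"
        using cost_measurable[of borel] by (simp add: case_prod_unfold)
      show "G \<in> borel_measurable borel" by (rule G_meas) simp
      show "ennreal (C (dist x y)) \<le> G x + G y" for x y
      proof -
        have "C (dist x y) \<le> h x + h y"
          using C_dist_triangle[of x y a] by (simp add: h_def dist_commute)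
        then show ?thesis unfolding G_def using h_nonneg by (simp add: ennreal_plus[symmetric] ennreal_leI del: ennreal_plus)
      qed
    qed
    then show ?case using elim(2) by (rule le_less_trans)
  qed
qed simp

end

theorem corollary1:
  fixes \<mu>s :: "nat \<Rightarrow> 'a::polish_space measure" and \<mu> :: "'a measure"
    and c :: "'a \<Rightarrow> 'a \<Rightarrow> real" and C :: "real \<Rightarrow> real" and K :: real and a :: 'a
  assumes "\<And>n. n \<ge> 1 \<Longrightarrow> prob_space (\<mu>s n)" and "\<And>n. n \<ge> 1 \<Longrightarrow> sets (\<mu>s n) = sets borel"
    and "prob_space \<mu>" and "sets \<mu> = sets borel"
    and "\<And>x y. c x y = C (dist x y)"
    and "C \<in> {0..} \<rightarrow> {0..}" and "mono_on {0..} C" and "continuous_on {0..} C" and "C 0 = 0"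
    and C_nontrivial: "\<exists>y\<ge>0. C y \<noteq> 0"
    and "K > 0" and "\<And>y. y \<ge> 0 \<Longrightarrow> C (2 * y) \<le> K * C y"
  shows "((\<forall>n\<ge>1. (\<integral>\<^sup>+ x. ennreal (C (2 * dist x a)) \<partial>\<mu>s n) < \<infinity>) \<and>
            (\<integral>\<^sup>+ x. ennreal (C (2 * dist x a)) \<partial>\<mu>) < \<infinity>
          \<longleftrightarrow>
          (\<forall>n\<ge>1. (\<integral>\<^sup>+ x. ennreal (C (dist x a)) \<partial>\<mu>s n) < \<infinity>) \<and>
            (\<integral>\<^sup>+ x. ennreal (C (dist x a)) \<partial>\<mu>) < \<infinity>) \<and>
         ((\<forall>n\<ge>1. (\<integral>\<^sup>+ x. ennreal (C (dist x a)) \<partial>\<mu>s n) < \<infinity>) \<and>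
            (\<integral>\<^sup>+ x. ennreal (C (dist x a)) \<partial>\<mu>) < \<infinity>
          \<longrightarrow>
          ((\<lambda>n. transport_dist c (\<mu>s n) \<mu>) \<longlonglongrightarrow> 0
           \<longleftrightarrow>
           weakly_converges \<mu>s \<mu> \<and>
           (\<lambda>n. \<integral>\<^sup>+ x. ennreal (C (dist x a)) \<partial>\<mu>s n)
             \<longlonglongrightarrow> (\<integral>\<^sup>+ x. ennreal (C (dist x a)) \<partial>\<mu>)))"
proof -
  interpret doubling_cost C K
    using assms(6-12) by unfold_locales
  have c: "c = (\<lambda>x y. C (dist x y))" using assms(5) by (intro ext)
  have "(\<forall>n\<ge>1. (\<integral>\<^sup>+ x. ennreal (C (2 * dist x a)) \<partial>\<mu>s n) < \<infinity>) \<and>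
      (\<integral>\<^sup>+ x. ennreal (C (2 * dist x a)) \<partial>\<mu>) < \<infinity> \<longleftrightarrow>
    (\<forall>n\<ge>1. (\<integral>\<^sup>+ x. ennreal (C (dist x a)) \<partial>\<mu>s n) < \<infinity>) \<and>
      (\<integral>\<^sup>+ x. ennreal (C (dist x a)) \<partial>\<mu>) < \<infinity>"
    using assms(2,4) by (simp add: doubled_moment_finite_iff)
  moreover have "(\<lambda>n. transport_dist c (\<mu>s n) \<mu>) \<longlonglongrightarrow> 0 \<longleftrightarrow>
      weakly_converges \<mu>s \<mu> \<and>
      (\<lambda>n. \<integral>\<^sup>+ x. ennreal (C (dist x a)) \<partial>\<mu>s n) \<longlonglongrightarrow> (\<integral>\<^sup>+ x. ennreal (C (dist x a)) \<partial>\<mu>)"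
    if "(\<forall>n\<ge>1. (\<integral>\<^sup>+ x. ennreal (C (dist x a)) \<partial>\<mu>s n) < \<infinity>) \<and>
      (\<integral>\<^sup>+ x. ennreal (C (dist x a)) \<partial>\<mu>) < \<infinity>"
    unfolding c using that
      transport_convergence_imp_weak[OF assms(3,4)]
      transport_convergence_imp_moments[where \<mu>s=\<mu>s, OF assms(1-4)]
      weak_and_moments_imp_transport_convergence[where \<mu>s=\<mu>s, OF assms(1-4)]
    by auto
  ultimately show ?thesis by blast
qed

end
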